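(* There is a universal constant $c_0>0$ such that for every $c_{\mathtt s}\ge c_0$ the following holds. Let $D\ge2$ be an integer, $n,d\ge1$ integers, $K_n\in[n]$, $K_d\in[d]$, $\lambda\in(0,1)$, and assume $$\max\left\{\frac{K_n}{n},\ \frac{K_d}{d},\ \frac{\lambda K_n}{\sqrt n},\ \frac{\lambda K_d}{\sqrt d},\ \lambda\right\}\le D^{-8c_{\mathtt s}} .$$ Then $$\inf_{f\in\mathcal P_{\le D}}\mathbb E[(f-x^\star)^2]\ \ge\ \frac{\mathbb E[x^{\star2}]}{2}.$$
   Context: Bayesian block model: $M=\lambda\mathbf 1\{S\times T\}$ (entry $\lambda$ on $S\times T$, zero elsewhere), where $S\subset[n]$ and $T\subset[d]$ are random and the variables $\mathbf 1\{i\in S\}$, $i\in[n]$, and $\mathbf 1\{j\in T\}$, $j\in[d]$, are all independent, Bernoulli with parameter $K_n/n$ and $K_d/d$ respectively. Conditionally on $M$, the entries of $Y\in\{-1,1\}^{n\times d}$ are independent with $\mathbb P[Y_{i,k}=1\mid M]=(1+M_{i,k})/2$. $\mathbb E$ is expectation under the joint law of $(M,Y)$. The target is $x^\star=\mathbf 1\{\exists k\in[d]:\ M_{1,k}>0\}$. $\mathcal P_{\le D}$ is the set of real polynomials of degree at most $D$ in the entries of $Y$; $f$ stands for $f(Y)$. *)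

theory Defs
  imports "HOL-Probability.Probability"
begin

definition cells :: "nat \<Rightarrow> nat \<Rightarrow> (nat \<times> nat) set" where
  "cells n d = {1..n} \<times> {1..d}"

text \<open>Random subset of \<open>{1..m}\<close>, encoded by its membership predicate, each element being kept
  independently with probability \<open>p\<close>.\<close>

definition random_subset :: "nat \<Rightarrow> real \<Rightarrow> (nat \<Rightarrow> bool) pmf" where
  "random_subset m p = Pi_pmf {1..m} False (\<lambda>_. bernoulli_pmf p)"

definition block_matrix :: "real \<Rightarrow> (nat \<Rightarrow> bool) \<Rightarrow> (nat \<Rightarrow> bool) \<Rightarrow> nat \<times> nat \<Rightarrow> real" where
  "block_matrix l s t = (\<lambda>(i, k). if s i \<and> t k then l else 0)"

definition signal_pmf :: "nat \<Rightarrow> nat \<Rightarrow> nat \<Rightarrow> nat \<Rightarrow> real \<Rightarrow> (nat \<times> nat \<Rightarrow> real) pmf" where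
  "signal_pmf n d Kn Kd l =
     map_pmf (\<lambda>(s, t). block_matrix l s t)
       (pair_pmf (random_subset n (real Kn / real n)) (random_subset d (real Kd / real d)))"

text \<open>Law of \<open>Y\<close> given \<open>M\<close>; matrices are extended by \<open>0\<close> outside \<open>cells n d\<close>.\<close>

definition observation_pmf ::
    "nat \<Rightarrow> nat \<Rightarrow> (nat \<times> nat \<Rightarrow> real) \<Rightarrow> (nat \<times> nat \<Rightarrow> real) pmf" where
  "observation_pmf n d M =
     Pi_pmf (cells n d) 0
       (\<lambda>p. map_pmf (\<lambda>b. if b then 1 else - 1) (bernoulli_pmf ((1 + M p) / 2)))"

definition model_pmf ::
    "nat \<Rightarrow> nat \<Rightarrow> nat \<Rightarrow> nat \<Rightarrow> real \<Rightarrow> ((nat \<times> nat \<Rightarrow> real) \<times> (nat \<times> nat \<Rightarrow> real)) pmf" where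
  "model_pmf n d Kn Kd l =
     bind_pmf (signal_pmf n d Kn Kd l) (\<lambda>M. map_pmf (\<lambda>Y. (M, Y)) (observation_pmf n d M))"

definition target :: "nat \<Rightarrow> (nat \<times> nat \<Rightarrow> real) \<Rightarrow> real" where
  "target d M = of_bool (\<exists>k\<in>{1..d}. M (1, k) > 0)"

text \<open>Polynomial functions of total degree at most \<open>D\<close> in the variables \<open>Y p\<close>,
  \<open>p \<in> cells n d\<close>: finite real combinations of monomials with exponent vectors \<open>a\<close>. Values of
  \<open>a\<close> outside \<open>cells n d\<close> play no role.\<close>

definition polys_le :: "nat \<Rightarrow> nat \<Rightarrow> nat \<Rightarrow> ((nat \<times> nat \<Rightarrow> real) \<Rightarrow> real) set" where
  "polys_le n d D =
     {f. \<exists>(A :: (nat \<times> nat \<Rightarrow> nat) set) c. finite A \<and>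
           (\<forall>a\<in>A. (\<Sum>p\<in>cells n d. a p) \<le> D) \<and>
           f = (\<lambda>Y. \<Sum>a\<in>A. c a * (\<Prod>p\<in>cells n d. Y p ^ a p))}"

end

theory Submission imports Defs begin

text \<open>
  Write \<open>p = Kn / n\<close> and \<open>q = Kd / d\<close>. The target \<open>x\<close> is the indicator of
  \<open>1 \<in> S\<close> minus the indicator of \<open>1 \<in> S, T = {}\<close>, and its second moment is
  \<open>p * (1 - (1 - q) ^ d) \<ge> p / 2\<close>. The proof is by duality: if a random variable \<open>\<phi>\<close>
  satisfies \<open>E[f x] = E[f \<phi>]\<close> for every polynomial \<open>f\<close> of degree at most \<open>D\<close>,
  then
  \<open>E[(f - x)\<^sup>2] = E[(f - \<phi>)\<^sup>2] - E[\<phi>\<^sup>2] + E[x\<^sup>2] \<ge> E[x\<^sup>2] - E[\<phi>\<^sup>2]\<close>.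
  So it is enough to exhibit such a \<open>\<phi>\<close> with \<open>E[\<phi>\<^sup>2] = O(p\<^sup>2)\<close>, since
  \<open>p\<close> is small.

  In place of \<open>x\<close>, take first the indicator of \<open>1 \<in> S\<close>, and look for a combination
  \<open>\<psi>\<close>, with coefficients \<open>\<kappa> \<gamma>\<close>, of the products over \<open>\<gamma>\<close> of
  the variables \<open>z = (Y - M) / (1 - M\<^sup>2)\<close>. Given \<open>M\<close>, these variables are independent and
  centred, with \<open>E[Y z] = 1\<close>. Testing against the monomial of an edge set \<open>\<alpha>\<close> turns the
  duality condition into a triangular system whose right hand side and matrix are moments of \<open>M\<close>; its solution
  is the family of joint cumulants of the indicator of \<open>1 \<in> S\<close> and the entries of \<open>M\<close> in
  \<open>\<alpha>\<close> (\<open>expectation_dual_certificate_eq\<close>). Distinct products are orthogonal given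
  \<open>M\<close>, so \<open>E[\<psi>\<^sup>2]\<close> is at most the sum of
  \<open>2 ^ card \<gamma> * (\<kappa> \<gamma>)\<^sup>2\<close> (\<open>expectation_dual_certificate_square_le\<close>).

  View an edge set as a bipartite graph on rows and columns. A cumulant vanishes unless all edges are connected to row 1
  (\<open>cumulant_eq_0\<close>), and in size it is at most \<open>(4 D) ^ card \<gamma>\<close> times the corresponding
  moment (\<open>abs_cumulant_le\<close>). The connected edge sets are built by adding one edge at a time. There are at most
  \<open>D * d\<close> edges to a new column, each costing a factor of order
  \<open>D\<^sup>2 * l\<^sup>2 * q\<^sup>2\<close>; at most \<open>D * n\<close> edges to a new row, each costing
  \<open>D\<^sup>2 * l\<^sup>2 * p\<^sup>2\<close>; and at most \<open>D\<^sup>2\<close> edges between old vertices, each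
  costing \<open>D\<^sup>2 * l\<^sup>2\<close>. Since \<open>d * q\<^sup>2 * l\<^sup>2\<close>,
  \<open>n * p\<^sup>2 * l\<^sup>2\<close> and \<open>l\<^sup>2\<close> are at most \<open>D powr -16\<close>, the total
  factor per edge is below \<open>1 / 2\<close> and the sum is at most twice its first term \<open>p\<^sup>2\<close>
  (\<open>sum_cumulant_squares_le\<close>).

  The event \<open>T = {}\<close> needs separate care: it can have constant probability, and it depends on all columns at
  once, so cumulants involving it do not vanish on edge sets away from row 1. But when \<open>T = {}\<close> the observation
  is independent of \<open>S\<close>, so there the indicator of \<open>1 \<in> S\<close> may be replaced by its mean
  \<open>p\<close> (\<open>expectation_mult_no_columns\<close>); this adds another \<open>O(p\<^sup>2)\<close> to
  \<open>E[\<phi>\<^sup>2]\<close>.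
\<close>

lemma finite_cells [simp]: "finite (cells n d)"
  by (simp add: cells_def)

section \<open>Moments and cumulants of the block\<close>

text \<open>
  A set of cells is read as the edge set of a bipartite graph between rows and columns. Row 1 is always counted as a vertex,
  because the target refers to it.
\<close>

definition row_set :: "(nat \<times> nat) set \<Rightarrow> nat set" where
  "row_set \<alpha> = insert 1 (fst ` \<alpha>)"

definition col_set :: "(nat \<times> nat) set \<Rightarrow> nat set" where
  "col_set \<alpha> = snd ` \<alpha>"

text \<open>
  The expectation of the product over \<open>\<alpha>\<close> of the entries of \<open>M\<close>, and in
  \<open>rooted_moment\<close> the same with the indicator of \<open>1 \<in> S\<close> as an additional factor;
  \<open>p\<close> and \<open>q\<close> are the inclusion probabilities of a row and of a column.
\<close>

definition moment :: "real \<Rightarrow> real \<Rightarrow> real \<Rightarrow> (nat \<times> nat) set \<Rightarrow> real" where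
  "moment l p q \<alpha> = l ^ card \<alpha> * p ^ card (fst ` \<alpha>) * q ^ card (col_set \<alpha>)"

definition rooted_moment :: "real \<Rightarrow> real \<Rightarrow> real \<Rightarrow> (nat \<times> nat) set \<Rightarrow> real" where
  "rooted_moment l p q \<alpha> = l ^ card \<alpha> * p ^ card (row_set \<alpha>) * q ^ card (col_set \<alpha>)"

text \<open>
  The recursion is the triangular system for the coefficients of the dual certificate, solved for its diagonal term. Its
  solution is the joint cumulant of the indicator of \<open>1 \<in> S\<close> with the entries of \<open>M\<close> indexed by
  \<open>\<alpha>\<close>. The case distinction makes the recursion well-founded, on the cardinality.
\<close>

function cumulant :: "real \<Rightarrow> real \<Rightarrow> real \<Rightarrow> (nat \<times> nat) set \<Rightarrow> real" where
  "cumulant l p q \<alpha> = rooted_moment l p q \<alpha> -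
     (if finite \<alpha> then \<Sum>\<gamma> | \<gamma> \<subset> \<alpha>. cumulant l p q \<gamma> * moment l p q (\<alpha> - \<gamma>) else 0)"
  by pat_completeness auto
termination
  by (relation "Wellfounded.measure (\<lambda>(l, p, q, \<alpha>). card \<alpha>)") (auto intro: psubset_card_mono)

declare cumulant.simps [simp del]

lemma rooted_moment_eq_sum_cumulant:
  assumes "finite \<alpha>"
  shows "rooted_moment l p q \<alpha> = (\<Sum>\<gamma>\<in>Pow \<alpha>. cumulant l p q \<gamma> * moment l p q (\<alpha> - \<gamma>))"
proof -
  have *: "Pow \<alpha> = insert \<alpha> {\<gamma>. \<gamma> \<subset> \<alpha>}" by auto
  have "finite {\<gamma>. \<gamma> \<subset> \<alpha>}"
    by (rule finite_subset[of _ "Pow \<alpha>"]) (use assms in auto)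
  then show ?thesis
    using assms unfolding * by (simp add: moment_def col_set_def cumulant.simps[of l p q \<alpha>])
qed

section \<open>Vanishing outside the graphs connected to row 1\<close>

text \<open>
  The edge sets of connected graphs containing row 1, generated one new edge at a time. This form is what the summation over
  all such graphs peels off later.
\<close>

inductive rooted :: "(nat \<times> nat) set \<Rightarrow> bool" where
  empty: "rooted {}"
| grow: "rooted \<alpha> \<Longrightarrow> e \<notin> \<alpha> \<Longrightarrow> fst e \<in> row_set \<alpha> \<or> snd e \<in> col_set \<alpha> \<Longrightarrow> rooted (insert e \<alpha>)"

lemma rooted_finite: "rooted \<alpha> \<Longrightarrow> finite \<alpha>"
  by (induction rule: rooted.induct) auto

text \<open>
  The connected component of row 1 is a maximal rooted subset: an edge outside it that touched it could be added. A rooted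
  subset of \<open>\<alpha>\<close>, grown from row 1, can never leave it.
\<close>

lemma root_component:
  assumes "finite \<alpha>"
  obtains \<beta> where "rooted \<beta>" "\<beta> \<subseteq> \<alpha>"
    "\<And>e. e \<in> \<alpha> - \<beta> \<Longrightarrow> fst e \<notin> row_set \<beta> \<and> snd e \<notin> col_set \<beta>"
    "\<And>\<gamma>. rooted \<gamma> \<Longrightarrow> \<gamma> \<subseteq> \<alpha> \<Longrightarrow> \<gamma> \<subseteq> \<beta>"
proof -
  let ?R = "{\<beta>. rooted \<beta> \<and> \<beta> \<subseteq> \<alpha>}"
  have "finite ?R"
    by (rule finite_subset[of _ "Pow \<alpha>"]) (use assms in auto)
  moreover have "?R \<noteq> {}"
    using rooted.empty by auto
  ultimately have "\<exists>\<beta>\<in>?R. \<forall>\<gamma>\<in>?R. \<beta> \<subseteq> \<gamma> \<longrightarrow> \<beta> = \<gamma>"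
    by (rule finite_has_maximal)
  then obtain \<beta> where "\<beta> \<in> ?R" and all: "\<forall>\<gamma>\<in>?R. \<beta> \<subseteq> \<gamma> \<longrightarrow> \<beta> = \<gamma>"
    by (rule bexE)
  then have \<beta>: "rooted \<beta>" "\<beta> \<subseteq> \<alpha>" by auto
  have max: "\<beta> = \<gamma>" if "rooted \<gamma>" "\<gamma> \<subseteq> \<alpha>" "\<beta> \<subseteq> \<gamma>" for \<gamma>
    using all that by simp
  have sep: "fst e \<notin> row_set \<beta> \<and> snd e \<notin> col_set \<beta>" if "e \<in> \<alpha> - \<beta>" for e
    using max[of "insert e \<beta>"] rooted.grow[OF \<beta>(1), of e] that \<beta>(2) by blast
  have "\<gamma> \<subseteq> \<beta>" if "rooted \<gamma>" "\<gamma> \<subseteq> \<alpha>" for \<gamma>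
    using that
  proof (induction rule: rooted.induct)
    case (grow \<gamma> e)
    then have "fst e \<in> row_set \<beta> \<or> snd e \<in> col_set \<beta>"
      by (auto simp: row_set_def col_set_def)
    then show ?case using grow sep by blast
  qed auto
  then show thesis using that \<beta> sep by blast
qed

text \<open>
  Parts without common rows or columns depend on disjoint groups of the independent membership variables.
\<close>

lemma moment_disjoint_Un:
  assumes "finite \<alpha>" "finite \<beta>" "fst ` \<alpha> \<inter> fst ` \<beta> = {}" "col_set \<alpha> \<inter> col_set \<beta> = {}"
  shows "moment l p q (\<alpha> \<union> \<beta>) = moment l p q \<alpha> * moment l p q \<beta>"
proof -
  have "\<alpha> \<inter> \<beta> = {}" using assms(3) by auto
  then show ?thesis
    using assms
    by (simp add: moment_def col_set_def image_Un card_Un_disjoint power_add)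
qed

lemma rooted_moment_disjoint_Un:
  assumes "finite \<alpha>" "finite \<beta>" "row_set \<alpha> \<inter> fst ` \<beta> = {}" "col_set \<alpha> \<inter> col_set \<beta> = {}"
  shows "rooted_moment l p q (\<alpha> \<union> \<beta>) = rooted_moment l p q \<alpha> * moment l p q \<beta>"
proof -
  have "\<alpha> \<inter> \<beta> = {}" using assms(3) by (auto simp: row_set_def)
  moreover have "row_set (\<alpha> \<union> \<beta>) = row_set \<alpha> \<union> fst ` \<beta>" by (auto simp: row_set_def)
  moreover have "finite (row_set \<alpha>)" using assms by (simp add: row_set_def)
  ultimately show ?thesis
    using assms
    by (simp add: rooted_moment_def moment_def col_set_def image_Un card_Un_disjoint power_add)
qed

text \<open>
  Let \<open>\<beta>\<close> be the component of row 1. Inductively only the subsets of \<open>\<beta>\<close>, and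
  \<open>\<alpha>\<close> itself, contribute to the recursion at \<open>\<alpha>\<close>. The independent factor of
  \<open>\<alpha> - \<beta>\<close> comes out of every term with \<open>\<gamma> \<subseteq> \<beta>\<close>, and what
  remains is the recursion at \<open>\<beta>\<close>. Hence these terms already add up to the rooted moment of
  \<open>\<alpha>\<close>, and nothing is left for the cumulant of \<open>\<alpha>\<close>.
\<close>

lemma cumulant_eq_0:
  assumes "finite \<alpha>" "\<not> rooted \<alpha>"
  shows "cumulant l p q \<alpha> = 0"
  using assms
proof (induction "card \<alpha>" arbitrary: \<alpha> rule: less_induct)
  case less
  note fin = less.prems(1)
  obtain \<beta> where \<beta>: "rooted \<beta>" "\<beta> \<subseteq> \<alpha>"
    and sep: "\<And>e. e \<in> \<alpha> - \<beta> \<Longrightarrow> fst e \<notin> row_set \<beta> \<and> snd e \<notin> col_set \<beta>"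
    and max: "\<And>\<gamma>. rooted \<gamma> \<Longrightarrow> \<gamma> \<subseteq> \<alpha> \<Longrightarrow> \<gamma> \<subseteq> \<beta>"
    using root_component[OF fin] by blast
  have fin\<beta>: "finite \<beta>" using \<beta>(1) by (rule rooted_finite)
  have ne: "\<alpha> \<noteq> \<beta>" using \<beta>(1) less.prems by blast
  have outside: "row_set \<beta> \<inter> fst ` (\<alpha> - \<beta>) = {}" "col_set \<beta> \<inter> col_set (\<alpha> - \<beta>) = {}"
    using sep unfolding col_set_def[of "\<alpha> - \<beta>"] by blast+
  let ?t = "\<lambda>\<gamma>. cumulant l p q \<gamma> * moment l p q (\<alpha> - \<gamma>)"
  have split: "moment l p q (\<alpha> - \<gamma>) = moment l p q (\<beta> - \<gamma>) * moment l p q (\<alpha> - \<beta>)"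
    if "\<gamma> \<subseteq> \<beta>" for \<gamma>
  proof -
    have "\<alpha> - \<gamma> = (\<beta> - \<gamma>) \<union> (\<alpha> - \<beta>)" using that \<beta> by blast
    moreover have "fst ` (\<beta> - \<gamma>) \<subseteq> row_set \<beta>" "col_set (\<beta> - \<gamma>) \<subseteq> col_set \<beta>"
      by (auto simp: row_set_def col_set_def)
    then have "fst ` (\<beta> - \<gamma>) \<inter> fst ` (\<alpha> - \<beta>) = {}" "col_set (\<beta> - \<gamma>) \<inter> col_set (\<alpha> - \<beta>) = {}"
      using outside by blast+
    ultimately show ?thesis
      using fin fin\<beta> by (metis finite_Diff moment_disjoint_Un)
  qed
  have "rooted_moment l p q \<alpha> = (\<Sum>\<gamma>\<in>Pow \<alpha>. ?t \<gamma>)"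
    by (rule rooted_moment_eq_sum_cumulant[OF fin])
  also have "\<dots> = (\<Sum>\<gamma>\<in>insert \<alpha> (Pow \<beta>). ?t \<gamma>)"
  proof (rule sum.mono_neutral_right)
    show "\<forall>\<gamma>\<in>Pow \<alpha> - insert \<alpha> (Pow \<beta>). ?t \<gamma> = 0"
    proof
      fix \<gamma> assume \<gamma>: "\<gamma> \<in> Pow \<alpha> - insert \<alpha> (Pow \<beta>)"
      then have "\<gamma> \<subset> \<alpha>" "\<not> rooted \<gamma>" using max by auto
      then have "cumulant l p q \<gamma> = 0"
        using less.hyps[of \<gamma>] fin by (meson finite_subset psubset_card_mono psubset_imp_subset)
      then show "?t \<gamma> = 0" by simp
    qed
  qed (use fin \<beta> in auto)
  also have "\<dots> = cumulant l p q \<alpha> + (\<Sum>\<gamma>\<in>Pow \<beta>. ?t \<gamma>)"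
    using fin\<beta> ne \<beta> by (subst sum.insert) (auto simp: moment_def col_set_def)
  also have "(\<Sum>\<gamma>\<in>Pow \<beta>. ?t \<gamma>) = rooted_moment l p q \<beta> * moment l p q (\<alpha> - \<beta>)"
    unfolding rooted_moment_eq_sum_cumulant[OF fin\<beta>] sum_distrib_right
  proof (rule sum.cong[OF refl])
    fix \<gamma> assume "\<gamma> \<in> Pow \<beta>"
    then show "?t \<gamma> = cumulant l p q \<gamma> * moment l p q (\<beta> - \<gamma>) * moment l p q (\<alpha> - \<beta>)"
      by (subst split) simp_all
  qed
  also have "\<dots> = rooted_moment l p q (\<beta> \<union> (\<alpha> - \<beta>))"
    using fin fin\<beta> outside by (intro rooted_moment_disjoint_Un[symmetric]) auto
  also have "\<beta> \<union> (\<alpha> - \<beta>) = \<alpha>" using \<beta> by blast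
  finally show ?case by simp
qed

section \<open>Size of the cumulants\<close>

text \<open>
  Splitting an edge set can only duplicate vertices, which costs extra factors \<open>p, q \<le> 1\<close>.
\<close>

lemma rooted_moment_mult_le:
  assumes "finite \<alpha>" "\<gamma> \<subseteq> \<alpha>" "0 \<le> l" "0 \<le> p" "p \<le> 1" "0 \<le> q" "q \<le> 1"
  shows "rooted_moment l p q \<gamma> * moment l p q (\<alpha> - \<gamma>) \<le> rooted_moment l p q \<alpha>"
proof -
  have fin: "finite \<gamma>" using assms finite_subset by blast
  have un: "\<gamma> \<union> (\<alpha> - \<gamma>) = \<alpha>" using assms by blast
  have r: "card (row_set \<alpha>) \<le> card (row_set \<gamma>) + card (fst ` (\<alpha> - \<gamma>))"
  proof -
    have "row_set \<alpha> = row_set \<gamma> \<union> fst ` (\<alpha> - \<gamma>)" using assms(2) by (auto simp: row_set_def)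
    then show ?thesis by (simp add: card_Un_le)
  qed
  have c: "card (col_set \<alpha>) \<le> card (col_set \<gamma>) + card (col_set (\<alpha> - \<gamma>))"
  proof -
    have "col_set \<alpha> = col_set \<gamma> \<union> col_set (\<alpha> - \<gamma>)" using assms(2) by (auto simp: col_set_def)
    then show ?thesis by (simp add: card_Un_le)
  qed
  have l: "card \<alpha> = card \<gamma> + card (\<alpha> - \<gamma>)"
    using assms fin by (metis card_Diff_subset card_mono le_add_diff_inverse)
  have "rooted_moment l p q \<gamma> * moment l p q (\<alpha> - \<gamma>) =
      l ^ card \<alpha> * p ^ (card (row_set \<gamma>) + card (fst ` (\<alpha> - \<gamma>)))
        * q ^ (card (col_set \<gamma>) + card (col_set (\<alpha> - \<gamma>)))"
    by (simp add: rooted_moment_def moment_def l power_add)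
  also have "\<dots> \<le> l ^ card \<alpha> * p ^ card (row_set \<alpha>) * q ^ card (col_set \<alpha>)"
    using assms power_decreasing[OF r, of p] power_decreasing[OF c, of q]
    by (intro mult_mono[OF mult_left_mono]) auto
  finally show ?thesis by (simp add: rooted_moment_def)
qed

lemma sum_Pow_power_card:
  fixes x :: real
  assumes "finite A"
  shows "(\<Sum>B\<in>Pow A. x ^ card B) = (1 + x) ^ card A"
  using prod_add[of A "\<lambda>_. x" "\<lambda>_. 1"] assms by (simp add: add.commute)

text \<open>
  The numerical step of the induction for cumulants. With a weight \<open>X ^ j\<close> for every proper subset of size
  \<open>j\<close> of a \<open>k\<close>-element set, all these subsets together weigh \<open>(1 + X) ^ k - X ^ k\<close>,
  and this plus 1 must not exceed \<open>X ^ k\<close>. It does not, because \<open>(1 + 1 / X) ^ k \<le> 4 / 3\<close> by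
  Bernoulli's inequality and \<open>X ^ k \<ge> 4\<close>.
\<close>

lemma power_Suc_base_le:
  fixes X :: real
  assumes "1 \<le> k" "k \<le> D" "4 * real D \<le> X"
  shows "1 + (1 + X) ^ k \<le> 2 * X ^ k"
proof -
  have D: "1 \<le> real D" using assms(1,2) by simp
  then have X: "4 \<le> X" using assms(3) by linarith
  have "3 / 4 \<le> 1 - real k / (1 + X)"
    using assms X by (simp add: field_simps)
  also have "\<dots> \<le> (1 - 1 / (1 + X)) ^ k"
    using Bernoulli_inequality[of "- 1 / (1 + X)" k] X by (simp add: field_simps)
  also have "1 - 1 / (1 + X) = X / (1 + X)" using X by (simp add: field_simps)
  finally have "3 * (1 + X) ^ k \<le> 4 * X ^ k"
    using X by (simp add: power_divide field_simps)
  moreover have "4 \<le> X ^ k"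
    using X assms(1) power_increasing[of 1 k X] by simp
  ultimately show ?thesis by linarith
qed

lemma abs_cumulant_le:
  assumes "finite \<alpha>" "card \<alpha> \<le> D" "0 \<le> l" "0 \<le> p" "p \<le> 1" "0 \<le> q" "q \<le> 1"
  shows "\<bar>cumulant l p q \<alpha>\<bar> \<le> (4 * real D) ^ card \<alpha> * rooted_moment l p q \<alpha>"
  using assms(1,2)
proof (induction "card \<alpha>" arbitrary: \<alpha> rule: less_induct)
  case less
  note fin = less.prems(1)
  let ?X = "4 * real D"
  have rm: "0 \<le> rooted_moment l p q \<alpha>" for \<alpha> using assms by (simp add: rooted_moment_def)
  have m: "0 \<le> moment l p q \<alpha>" for \<alpha> using assms by (simp add: moment_def)
  have finP: "finite {\<gamma>. \<gamma> \<subset> \<alpha>}"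
    by (rule finite_subset[of _ "Pow \<alpha>"]) (use fin in auto)
  have "Pow \<alpha> = insert \<alpha> {\<gamma>. \<gamma> \<subset> \<alpha>}" by auto
  then have Psum: "(\<Sum>\<gamma> | \<gamma> \<subset> \<alpha>. ?X ^ card \<gamma>) = (1 + ?X) ^ card \<alpha> - ?X ^ card \<alpha>"
    using sum_Pow_power_card[OF fin, of ?X] finP by simp
  show ?case
  proof (cases "card \<alpha> = 0")
    case True
    then have "\<alpha> = {}" using fin by simp
    then show ?thesis using rm[of "{}"] by (simp add: cumulant.simps[of _ _ _ "{}"])
  next
    case False
    have "\<bar>cumulant l p q \<alpha>\<bar> \<le> \<bar>rooted_moment l p q \<alpha>\<bar> +
        \<bar>\<Sum>\<gamma> | \<gamma> \<subset> \<alpha>. cumulant l p q \<gamma> * moment l p q (\<alpha> - \<gamma>)\<bar>"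
      using fin unfolding cumulant.simps[of l p q \<alpha>] by simp
    also have "\<dots> \<le> rooted_moment l p q \<alpha> + (\<Sum>\<gamma> | \<gamma> \<subset> \<alpha>. ?X ^ card \<gamma> * rooted_moment l p q \<alpha>)"
    proof (intro add_mono order.trans[OF sum_abs] sum_mono)
      fix \<gamma> assume "\<gamma> \<in> {\<gamma>. \<gamma> \<subset> \<alpha>}"
      then have \<gamma>: "\<gamma> \<subset> \<alpha>" by simp
      then have "card \<gamma> < card \<alpha>" using fin by (rule psubset_card_mono[rotated])
      then have "\<bar>cumulant l p q \<gamma>\<bar> \<le> ?X ^ card \<gamma> * rooted_moment l p q \<gamma>"
        using less.hyps[of \<gamma>] less.prems \<gamma> finite_subset[of \<gamma> \<alpha>] by auto
      then have "\<bar>cumulant l p q \<gamma> * moment l p q (\<alpha> - \<gamma>)\<bar>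
          \<le> (?X ^ card \<gamma> * rooted_moment l p q \<gamma>) * moment l p q (\<alpha> - \<gamma>)"
        using m[of "\<alpha> - \<gamma>"] by (simp add: abs_mult mult_right_mono)
      also have "\<dots> = ?X ^ card \<gamma> * (rooted_moment l p q \<gamma> * moment l p q (\<alpha> - \<gamma>))" by simp
      also have "\<dots> \<le> ?X ^ card \<gamma> * rooted_moment l p q \<alpha>"
        using fin \<gamma> assms by (intro mult_left_mono rooted_moment_mult_le) auto
      finally show "\<bar>cumulant l p q \<gamma> * moment l p q (\<alpha> - \<gamma>)\<bar> \<le> ?X ^ card \<gamma> * rooted_moment l p q \<alpha>" .
    qed (use rm in simp)
    also have "\<dots> = rooted_moment l p q \<alpha> * (1 + ((1 + ?X) ^ card \<alpha> - ?X ^ card \<alpha>))"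
      unfolding sum_distrib_right[symmetric] Psum by (simp add: algebra_simps)
    also have "\<dots> \<le> rooted_moment l p q \<alpha> * ?X ^ card \<alpha>"
    proof (rule mult_left_mono[OF _ rm])
      have "1 \<le> card \<alpha>" using False by linarith
      then show "1 + ((1 + ?X) ^ card \<alpha> - ?X ^ card \<alpha>) \<le> ?X ^ card \<alpha>"
        using power_Suc_base_le[of "card \<alpha>" D ?X] less.prems by linarith
    qed
    finally show ?thesis by (simp add: mult.commute)
  qed
qed

section \<open>Summation over the connected graphs\<close>

definition weight :: "real \<Rightarrow> real \<Rightarrow> real \<Rightarrow> (nat \<times> nat) set \<Rightarrow> real" where
  "weight v P Q \<alpha> = v ^ card \<alpha> * P ^ card (row_set \<alpha>) * Q ^ card (col_set \<alpha>)"

definition rooted_layer :: "nat \<Rightarrow> nat \<Rightarrow> nat \<Rightarrow> (nat \<times> nat) set set" where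
  "rooted_layer n d m = {\<alpha>. rooted \<alpha> \<and> \<alpha> \<subseteq> cells n d \<and> card \<alpha> = m}"

lemma finite_rooted_layer [simp]: "finite (rooted_layer n d m)"
  by (rule finite_subset[of _ "Pow (cells n d)"]) (auto simp: rooted_layer_def)

lemma card_row_set_le: "finite \<alpha> \<Longrightarrow> card (row_set \<alpha>) \<le> Suc (card \<alpha>)"
  using card_image_le[of \<alpha> fst] by (simp add: row_set_def card_insert_if)

lemma card_col_set_le: "finite \<alpha> \<Longrightarrow> card (col_set \<alpha>) \<le> card \<alpha>"
  by (simp add: card_image_le col_set_def)

text \<open>
  An added edge either joins two old vertices (at most \<open>D * D\<close> choices), or reaches a new column
  (\<open>D * d\<close> choices, factor \<open>Q\<close>), or reaches a new row (\<open>n * D\<close> choices, factor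
  \<open>P\<close>). An edge with two new endpoints would be disconnected.
\<close>

lemma sum_weight_insert_le:
  assumes "finite \<alpha>" "\<alpha> \<subseteq> cells n d" "card \<alpha> < D" "0 \<le> v" "0 \<le> P" "0 \<le> Q"
  defines "N \<equiv> {e \<in> cells n d - \<alpha>. fst e \<in> row_set \<alpha> \<or> snd e \<in> col_set \<alpha>}"
  shows "(\<Sum>e\<in>N. weight v P Q (insert e \<alpha>))
      \<le> v * real D * (real d * Q + real n * P + real D) * weight v P Q \<alpha>"
proof -
  let ?A1 = "row_set \<alpha> \<times> col_set \<alpha>" and ?A2 = "row_set \<alpha> \<times> {1..d}" and ?A3 = "{1..n} \<times> col_set \<alpha>"
  let ?W = "weight v P Q \<alpha>"
  have W: "0 \<le> ?W" using assms by (simp add: weight_def)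
  have finr: "finite (row_set \<alpha>)" "finite (col_set \<alpha>)" using assms by (auto simp: row_set_def col_set_def)
  have R: "card (row_set \<alpha>) \<le> D" "card (col_set \<alpha>) \<le> D"
    using card_row_set_le[OF assms(1)] card_col_set_le[OF assms(1)] assms(3) by auto
  have finN: "finite N" unfolding N_def by auto
  have cnt: "(\<Sum>e\<in>N. of_bool (e \<in> A)) \<le> real (card A)" if "finite A" for A
  proof -
    have "(\<Sum>e\<in>N. of_bool (e \<in> A)) = real (card (N \<inter> A))"
      using finN by (simp add: of_bool_def sum.If_cases Int_def)
    also have "\<dots> \<le> real (card A)" using that by (simp add: card_mono)
    finally show ?thesis .
  qed
  \<comment> \<open>The three indicators may overlap; the overlap only enlarges the upper bound.\<close>
  have "(\<Sum>e\<in>N. weight v P Q (insert e \<alpha>))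
      \<le> (\<Sum>e\<in>N. v * ?W * (of_bool (e \<in> ?A1) + Q * of_bool (e \<in> ?A2) + P * of_bool (e \<in> ?A3)))"
  proof (rule sum_mono)
    fix e assume e: "e \<in> N"
    obtain i k where ik: "e = (i, k)" by force
    have cells: "i \<in> {1..n}" "k \<in> {1..d}" and new: "e \<notin> \<alpha>"
      and touch: "i \<in> row_set \<alpha> \<or> k \<in> col_set \<alpha>"
      using e ik by (auto simp: N_def cells_def)
    have r: "row_set (insert e \<alpha>) = insert i (row_set \<alpha>)" and c: "col_set (insert e \<alpha>) = insert k (col_set \<alpha>)"
      by (auto simp: row_set_def col_set_def ik)
    have eq: "weight v P Q (insert e \<alpha>) =
        v * ?W * (if i \<in> row_set \<alpha> then 1 else P) * (if k \<in> col_set \<alpha> then 1 else Q)"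
      using new assms(1) finr by (auto simp: weight_def r c insert_absorb)
    have "(if i \<in> row_set \<alpha> then 1 else P) * (if k \<in> col_set \<alpha> then 1 else Q)
        \<le> of_bool (e \<in> ?A1) + Q * of_bool (e \<in> ?A2) + P * of_bool (e \<in> ?A3)"
      using touch cells assms by (auto simp: ik)
    then have "v * ?W * ((if i \<in> row_set \<alpha> then 1 else P) * (if k \<in> col_set \<alpha> then 1 else Q))
        \<le> v * ?W * (of_bool (e \<in> ?A1) + Q * of_bool (e \<in> ?A2) + P * of_bool (e \<in> ?A3))"
      using W assms by (intro mult_left_mono) auto
    then show "weight v P Q (insert e \<alpha>)
        \<le> v * ?W * (of_bool (e \<in> ?A1) + Q * of_bool (e \<in> ?A2) + P * of_bool (e \<in> ?A3))"
      by (simp only: eq mult.assoc)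
  qed
  also have "\<dots> = v * ?W * ((\<Sum>e\<in>N. of_bool (e \<in> ?A1)) + Q * (\<Sum>e\<in>N. of_bool (e \<in> ?A2))
      + P * (\<Sum>e\<in>N. of_bool (e \<in> ?A3)))"
    by (simp only: sum_distrib_left[symmetric] sum.distrib)
  also have "\<dots> \<le> v * ?W * (real (card ?A1) + Q * real (card ?A2) + P * real (card ?A3))"
    using W assms finr by (intro mult_left_mono add_mono cnt) auto
  also have "\<dots> \<le> v * ?W * (real D * real D + Q * (real D * real d) + P * (real n * real D))"
    using W assms R by (intro mult_left_mono add_mono) (auto simp: card_cartesian_product mult_mono)
  also have "\<dots> = v * real D * (real d * Q + real n * P + real D) * ?W"
    by (simp add: algebra_simps)
  finally show ?thesis .
qed

text \<open>
  Each layer is contained in the one-edge extensions of the layer before, so no graphs need to be counted.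
\<close>

lemma sum_weight_rooted_layer_Suc_le:
  assumes "m < D" "0 \<le> v" "0 \<le> P" "0 \<le> Q"
  shows "(\<Sum>\<alpha>\<in>rooted_layer n d (Suc m). weight v P Q \<alpha>)
      \<le> v * real D * (real d * Q + real n * P + real D) * (\<Sum>\<alpha>\<in>rooted_layer n d m. weight v P Q \<alpha>)"
proof -
  let ?N = "\<lambda>\<alpha>. {e \<in> cells n d - \<alpha>. fst e \<in> row_set \<alpha> \<or> snd e \<in> col_set \<alpha>}"
  have W: "0 \<le> weight v P Q \<alpha>" for \<alpha> using assms by (simp add: weight_def)
  have sub: "rooted_layer n d (Suc m) \<subseteq>
      (\<lambda>(\<alpha>, e). insert e \<alpha>) ` (SIGMA \<alpha>:rooted_layer n d m. ?N \<alpha>)"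
  proof
    fix \<beta> assume "\<beta> \<in> rooted_layer n d (Suc m)"
    then have \<beta>: "rooted \<beta>" "\<beta> \<subseteq> cells n d" "card \<beta> = Suc m" by (auto simp: rooted_layer_def)
    from \<beta>(1) show "\<beta> \<in> (\<lambda>(\<alpha>, e). insert e \<alpha>) ` (SIGMA \<alpha>:rooted_layer n d m. ?N \<alpha>)"
    proof cases
      case empty
      then show ?thesis using \<beta>(3) by simp
    next
      case (grow \<alpha> e)
      then have "\<alpha> \<in> rooted_layer n d m" "e \<in> ?N \<alpha>"
        using \<beta> rooted_finite[of \<alpha>] by (auto simp: rooted_layer_def)
      then show ?thesis using grow by force
    qed
  qed
  have fin: "finite (SIGMA \<alpha>:rooted_layer n d m. ?N \<alpha>)" by auto
  have "(\<Sum>\<alpha>\<in>rooted_layer n d (Suc m). weight v P Q \<alpha>)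
      \<le> (\<Sum>\<alpha>\<in>(\<lambda>(\<alpha>, e). insert e \<alpha>) ` (SIGMA \<alpha>:rooted_layer n d m. ?N \<alpha>). weight v P Q \<alpha>)"
    using sub fin W by (intro sum_mono2) auto
  also have "\<dots> \<le> (\<Sum>x\<in>(SIGMA \<alpha>:rooted_layer n d m. ?N \<alpha>). weight v P Q ((\<lambda>(\<alpha>, e). insert e \<alpha>) x))"
    using sum_image_le[OF fin, of "weight v P Q" "\<lambda>(\<alpha>, e). insert e \<alpha>"] W by (simp add: o_def)
  also have "\<dots> = (\<Sum>\<alpha>\<in>rooted_layer n d m. \<Sum>e\<in>?N \<alpha>. weight v P Q (insert e \<alpha>))"
    by (subst sum.Sigma) (auto simp: case_prod_unfold)
  also have "\<dots> \<le> (\<Sum>\<alpha>\<in>rooted_layer n d m.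
      v * real D * (real d * Q + real n * P + real D) * weight v P Q \<alpha>)"
    using assms by (intro sum_mono sum_weight_insert_le)
      (auto simp: rooted_layer_def intro: rooted_finite)
  finally show ?thesis by (simp add: sum_distrib_left)
qed

lemma sum_weight_rooted_layer_le:
  assumes "m \<le> D" "0 \<le> v" "0 \<le> P" "0 \<le> Q"
    and "v * real D * (real d * Q + real n * P + real D) \<le> 1 / 2"
  shows "(\<Sum>\<alpha>\<in>rooted_layer n d m. weight v P Q \<alpha>) \<le> (1 / 2) ^ m * P"
  using assms(1)
proof (induction m)
  case 0
  have "rooted_layer n d 0 = {{}}"
    by (auto simp: rooted_layer_def intro: rooted.empty dest: rooted_finite)
  then show ?case by (simp add: weight_def row_set_def col_set_def)
next
  case (Suc m)
  have "0 \<le> (\<Sum>\<alpha>\<in>rooted_layer n d m. weight v P Q \<alpha>)"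
    using assms by (intro sum_nonneg) (simp add: weight_def)
  then have "(\<Sum>\<alpha>\<in>rooted_layer n d (Suc m). weight v P Q \<alpha>)
      \<le> 1 / 2 * (\<Sum>\<alpha>\<in>rooted_layer n d m. weight v P Q \<alpha>)"
    using sum_weight_rooted_layer_Suc_le[of m D v P Q n d] assms Suc.prems
    by (meson Suc_le_lessD mult_right_mono order.trans)
  then show ?case using Suc by simp
qed

text \<open>
  The weight \<open>v = 32 * D\<^sup>2 * l\<^sup>2\<close> per edge collects the factor \<open>2\<close>, the square of
  \<open>4 * D\<close> from the bound on the cumulants, and the square of \<open>l\<close> from the moments.
\<close>

lemma sum_cumulant_squares_le:
  assumes "0 \<le> l" "0 \<le> p" "p \<le> 1" "0 \<le> q" "q \<le> 1"
    and small: "32 * real D ^ 3 * l\<^sup>2 * (real d * q\<^sup>2 + real n * p\<^sup>2 + real D) \<le> 1 / 2"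
  shows "(\<Sum>\<alpha> | \<alpha> \<subseteq> cells n d \<and> card \<alpha> \<le> D. 2 ^ card \<alpha> * (cumulant l p q \<alpha>)\<^sup>2) \<le> 2 * p\<^sup>2"
proof -
  let ?v = "32 * (real D)\<^sup>2 * l\<^sup>2"
  let ?W = "weight ?v (p\<^sup>2) (q\<^sup>2)"
  have fin: "finite {\<alpha>. \<alpha> \<subseteq> cells n d \<and> card \<alpha> \<le> D}"
    by (rule finite_subset[of _ "Pow (cells n d)"]) auto
  have bound: "2 ^ card \<alpha> * (cumulant l p q \<alpha>)\<^sup>2 \<le> ?W \<alpha>" if "finite \<alpha>" "card \<alpha> \<le> D" for \<alpha>
  proof -
    have "(cumulant l p q \<alpha>)\<^sup>2 \<le> ((4 * real D) ^ card \<alpha> * rooted_moment l p q \<alpha>)\<^sup>2"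
      using abs_cumulant_le[OF that assms(1-5)] by (rule power2_le_iff_abs_le[THEN iffD2, rotated]) (use assms in \<open>simp add: rooted_moment_def\<close>)
    then have "2 ^ card \<alpha> * (cumulant l p q \<alpha>)\<^sup>2
        \<le> 2 ^ card \<alpha> * ((4 * real D) ^ card \<alpha> * rooted_moment l p q \<alpha>)\<^sup>2" by simp
    also have "\<dots> = (2 * ((4 * real D)\<^sup>2 * l\<^sup>2)) ^ card \<alpha> * (p\<^sup>2) ^ card (row_set \<alpha>) * (q\<^sup>2) ^ card (col_set \<alpha>)"
    proof -
      have sq: "(x ^ k)\<^sup>2 = (x\<^sup>2) ^ k" for x :: real and k
        by (simp add: power_mult[symmetric] mult.commute)
      define X where "X = 4 * real D"
      show ?thesis unfolding X_def[symmetric] rooted_moment_def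
        by (simp only: power_mult_distrib sq mult_ac)
    qed
    also have "2 * ((4 * real D)\<^sup>2 * l\<^sup>2) = ?v" by (simp add: power_mult_distrib)
    finally show ?thesis by (simp add: weight_def)
  qed
  have "(\<Sum>\<alpha> | \<alpha> \<subseteq> cells n d \<and> card \<alpha> \<le> D. 2 ^ card \<alpha> * (cumulant l p q \<alpha>)\<^sup>2)
      = (\<Sum>\<alpha>\<in>(\<Union>m\<le>D. rooted_layer n d m). 2 ^ card \<alpha> * (cumulant l p q \<alpha>)\<^sup>2)"
  proof (rule sum.mono_neutral_right[OF fin])
    show "(\<Union>m\<le>D. rooted_layer n d m) \<subseteq> {\<alpha>. \<alpha> \<subseteq> cells n d \<and> card \<alpha> \<le> D}"
      by (auto simp: rooted_layer_def)
    show "\<forall>\<alpha>\<in>{\<alpha>. \<alpha> \<subseteq> cells n d \<and> card \<alpha> \<le> D} - (\<Union>m\<le>D. rooted_layer n d m).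
        2 ^ card \<alpha> * (cumulant l p q \<alpha>)\<^sup>2 = 0"
      using finite_subset[OF _ finite_cells]
      by (auto simp: rooted_layer_def intro!: cumulant_eq_0)
  qed
  also have "\<dots> = (\<Sum>m\<le>D. \<Sum>\<alpha>\<in>rooted_layer n d m. 2 ^ card \<alpha> * (cumulant l p q \<alpha>)\<^sup>2)"
    by (rule sum.UNION_disjoint) (auto simp: rooted_layer_def intro: finite_subset[of _ "Pow (cells n d)"])
  also have "\<dots> \<le> (\<Sum>m\<le>D. \<Sum>\<alpha>\<in>rooted_layer n d m. ?W \<alpha>)"
    by (intro sum_mono bound) (auto simp: rooted_layer_def intro: rooted_finite)
  also have "\<dots> \<le> (\<Sum>m\<le>D. (1 / 2) ^ m * p\<^sup>2)"
    using small assms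
    by (intro sum_mono sum_weight_rooted_layer_le[where D=D]) (auto simp: power3_eq_cube power2_eq_square mult_ac)
  also have "\<dots> = (\<Sum>m\<le>D. (1 / 2) ^ m) * p\<^sup>2" by (simp add: sum_distrib_right)
  also have "\<dots> \<le> 2 * p\<^sup>2"
    by (intro mult_right_mono) (simp_all add: sum_gp0 del: power_one_over)
  finally show ?thesis .
qed

section \<open>Expectations over finite product distributions\<close>

abbreviation expect :: "'a pmf \<Rightarrow> ('a \<Rightarrow> real) \<Rightarrow> real" where
  "expect \<equiv> measure_pmf.expectation"

lemma expectation_bind_pmf_finite:
  assumes "finite (set_pmf p)" "\<And>x. x \<in> set_pmf p \<Longrightarrow> finite (set_pmf (f x))"
  shows "expect (bind_pmf p f) h = expect p (\<lambda>x. expect (f x) h)"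
proof -
  have "expect (bind_pmf p f) h = (\<Sum>a\<in>set_pmf p. pmf p a *\<^sub>R expect (f a) h)"
    using assms by (intro pmf_expectation_bind) auto
  also have "\<dots> = expect p (\<lambda>x. expect (f x) h)"
    by (rule integral_measure_pmf[symmetric]) (use assms in auto)
  finally show ?thesis .
qed

lemma expectation_pair_pmf_finite:
  assumes "finite (set_pmf p)" "finite (set_pmf q)"
  shows "expect (pair_pmf p q) h = expect p (\<lambda>x. expect q (\<lambda>y. h (x, y)))"
  using assms by (simp add: pair_pmf_def expectation_bind_pmf_finite)

lemma finite_set_Pi_pmf:
  assumes "finite A" "\<And>x. x \<in> A \<Longrightarrow> finite (set_pmf (p x))"
  shows "finite (set_pmf (Pi_pmf A dflt p))"
  using assms by (auto simp: set_Pi_pmf)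

text \<open>
  With finite supports the factors may have any sign, as the centred observations do.
\<close>

lemma expectation_prod_Pi_pmf_finite:
  assumes "finite A" "\<And>x. x \<in> A \<Longrightarrow> finite (set_pmf (p x))"
  shows "expect (Pi_pmf A dflt p) (\<lambda>y. \<Prod>x\<in>A. f x (y x)) = (\<Prod>x\<in>A. expect (p x) (f x))"
  using assms
proof (induction A)
  case (insert a A)
  have fin: "finite (set_pmf (Pi_pmf A dflt p))" "finite (set_pmf (p a))"
    using insert finite_set_Pi_pmf[of A p] by auto
  have "expect (Pi_pmf (insert a A) dflt p) (\<lambda>y. \<Prod>x\<in>insert a A. f x (y x))
      = expect (pair_pmf (p a) (Pi_pmf A dflt p)) (\<lambda>(z, y). \<Prod>x\<in>insert a A. f x ((y(a := z)) x))"
    using insert by (simp add: Pi_pmf_insert case_prod_unfold)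
  also have "\<dots> = expect (pair_pmf (p a) (Pi_pmf A dflt p)) (\<lambda>(z, y). f a z * (\<Prod>x\<in>A. f x (y x)))"
  proof -
    have "(\<Prod>x\<in>insert a A. f x ((y(a := z)) x)) = f a z * (\<Prod>x\<in>A. f x (y x))" for y z
      using insert.hyps by (simp, intro disjI2 prod.cong) auto
    then show ?thesis by simp
  qed
  also have "\<dots> = (\<Prod>x\<in>insert a A. expect (p x) (f x))"
    using insert fin by (simp add: expectation_pair_pmf_finite)
  finally show ?case .
qed simp

section \<open>Centred observations\<close>

text \<open>
  The normalisation is chosen so that, given \<open>M\<close>, the correlation with \<open>Y e\<close> is exactly 1. This
  puts ones on the diagonal of the triangular system and turns its matrix into moments of \<open>M\<close>.
\<close>

definition centred :: "(nat \<times> nat \<Rightarrow> real) \<Rightarrow> (nat \<times> nat \<Rightarrow> real) \<Rightarrow> nat \<times> nat \<Rightarrow> real" where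
  "centred M Y e = (Y e - M e) / (1 - (M e)\<^sup>2)"

lemma finite_set_observation_pmf [simp]: "finite (set_pmf (observation_pmf n d M))"
  unfolding observation_pmf_def by (intro finite_set_Pi_pmf) auto

lemma observation_pmf_support:
  assumes "Y \<in> set_pmf (observation_pmf n d M)" "e \<in> cells n d"
  shows "Y e = 1 \<or> Y e = - 1"
proof -
  let ?p = "map_pmf (\<lambda>b. if b then 1 else - 1) (bernoulli_pmf ((1 + M e) / 2)) :: real pmf"
  have "Y \<in> PiE_dflt (cells n d) 0
      (set_pmf \<circ> (\<lambda>e. map_pmf (\<lambda>b. if b then 1 else - 1) (bernoulli_pmf ((1 + M e) / 2))))"
    using assms(1) by (simp only: observation_pmf_def set_Pi_pmf finite_cells)
  then have "Y e \<in> set_pmf ?p"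
    using assms(2) unfolding PiE_dflt_def by (simp only: mem_Collect_eq o_def)
  also have "\<dots> \<subseteq> {1, - 1}" unfolding set_map_pmf by (rule image_subsetI) simp
  finally show ?thesis by simp
qed

lemma expectation_prod_observation:
  assumes "\<And>e. e \<in> cells n d \<Longrightarrow> \<bar>M e\<bar> \<le> 1"
  shows "expect (observation_pmf n d M) (\<lambda>Y. \<Prod>e\<in>cells n d. f e (Y e))
      = (\<Prod>e\<in>cells n d. f e 1 * ((1 + M e) / 2) + f e (- 1) * ((1 - M e) / 2))"
  unfolding observation_pmf_def
  apply (subst expectation_prod_Pi_pmf_finite)
  subgoal by simp
  subgoal by simp
proof (rule prod.cong)
  fix e assume "e \<in> cells n d"
  then have "0 \<le> (1 + M e) / 2" "(1 + M e) / 2 \<le> 1" using assms[of e] by auto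
  then show "expect (map_pmf (\<lambda>b. if b then 1 else - 1) (bernoulli_pmf ((1 + M e) / 2))) (f e)
      = f e 1 * ((1 + M e) / 2) + f e (- 1) * ((1 - M e) / 2)"
    by (simp add: field_simps)
qed simp

lemma centred_noise_moments:
  fixes m :: real
  assumes "\<bar>m\<bar> < 1"
  defines "z \<equiv> \<lambda>y. (y - m) / (1 - m\<^sup>2)"
  shows "z 1 * ((1 + m) / 2) + z (- 1) * ((1 - m) / 2) = 0"
    and "1 * z 1 * ((1 + m) / 2) + (- 1) * z (- 1) * ((1 - m) / 2) = 1"
    and "z 1 * z 1 * ((1 + m) / 2) + z (- 1) * z (- 1) * ((1 - m) / 2) = 1 / (1 - m\<^sup>2)"
proof -
  have pos: "0 < 1 + m" "0 < 1 - m" using assms by auto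
  have v: "1 - m\<^sup>2 = (1 + m) * (1 - m)" by (simp add: algebra_simps power2_eq_square)
  have z: "z 1 = 1 / (1 + m)" "z (- 1) = - 1 / (1 - m)"
    unfolding z_def v using pos by (simp_all add: divide_simps)
  show "z 1 * ((1 + m) / 2) + z (- 1) * ((1 - m) / 2) = 0"
    and "1 * z 1 * ((1 + m) / 2) + (- 1) * z (- 1) * ((1 - m) / 2) = 1"
    and "z 1 * z 1 * ((1 + m) / 2) + z (- 1) * z (- 1) * ((1 - m) / 2) = 1 / (1 - m\<^sup>2)"
    unfolding z v using pos by (simp_all add: divide_simps) (simp add: algebra_simps)
qed

text \<open>
  Conditional independence reduces this to one cell at a time: a cell of \<open>\<gamma>\<close> outside
  \<open>\<alpha>\<close> contributes mean 0, a cell of both contributes 1, and a cell of \<open>\<alpha>\<close> alone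
  contributes its mean \<open>M e\<close>.
\<close>

lemma expectation_monomial_centred:
  assumes M: "\<And>e. e \<in> cells n d \<Longrightarrow> 0 \<le> M e \<and> M e < 1"
    and sub: "\<alpha> \<subseteq> cells n d" "\<gamma> \<subseteq> cells n d"
  shows "expect (observation_pmf n d M) (\<lambda>Y. (\<Prod>e\<in>\<alpha>. Y e) * (\<Prod>e\<in>\<gamma>. centred M Y e))
      = (if \<gamma> \<subseteq> \<alpha> then \<Prod>e\<in>\<alpha> - \<gamma>. M e else 0)"
proof -
  let ?f = "\<lambda>e y. (if e \<in> \<alpha> then y else 1) * (if e \<in> \<gamma> then (y - M e) / (1 - (M e)\<^sup>2) else 1)"
  have "(\<Prod>e\<in>\<alpha>. Y e) * (\<Prod>e\<in>\<gamma>. centred M Y e) = (\<Prod>e\<in>cells n d. ?f e (Y e))" for Y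
    using sub by (simp add: prod.distrib prod.If_cases Int_absorb1 centred_def Int_def[symmetric])
  then have "expect (observation_pmf n d M) (\<lambda>Y. (\<Prod>e\<in>\<alpha>. Y e) * (\<Prod>e\<in>\<gamma>. centred M Y e))
      = (\<Prod>e\<in>cells n d. ?f e 1 * ((1 + M e) / 2) + ?f e (- 1) * ((1 - M e) / 2))"
    using M by (simp add: expectation_prod_observation[of n d M ?f] less_imp_le)
  also have "\<dots> = (\<Prod>e\<in>cells n d. if e \<in> \<gamma> then of_bool (e \<in> \<alpha>) else if e \<in> \<alpha> then M e else 1)"
  proof (intro prod.cong refl)
    fix e assume "e \<in> cells n d"
    then have "\<bar>M e\<bar> < 1" using M by auto
    note z = centred_noise_moments(1,2)[OF this]
    have half: "1 * ((1 + M e) / 2) + (- 1) * ((1 - M e) / 2) = M e" "(1 + M e) / 2 + (1 - M e) / 2 = 1"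
      by (simp_all add: field_simps)
    show "?f e 1 * ((1 + M e) / 2) + ?f e (- 1) * ((1 - M e) / 2)
        = (if e \<in> \<gamma> then of_bool (e \<in> \<alpha>) else if e \<in> \<alpha> then M e else 1)"
      using z half by (cases "e \<in> \<alpha>"; cases "e \<in> \<gamma>") simp_all
  qed
  also have "\<dots> = (if \<gamma> \<subseteq> \<alpha> then \<Prod>e\<in>\<alpha> - \<gamma>. M e else 0)"
  proof (cases "\<gamma> \<subseteq> \<alpha>")
    case True
    have "(\<Prod>e\<in>cells n d. if e \<in> \<gamma> then of_bool (e \<in> \<alpha>) else if e \<in> \<alpha> then M e else 1)
        = (\<Prod>e\<in>\<alpha> - \<gamma>. if e \<in> \<gamma> then of_bool (e \<in> \<alpha>) else if e \<in> \<alpha> then M e else 1)"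
      using True sub by (intro prod.mono_neutral_right) auto
    also have "\<dots> = (\<Prod>e\<in>\<alpha> - \<gamma>. M e)" by (rule prod.cong) auto
    finally show ?thesis using True by simp
  next
    case False
    then obtain e where "e \<in> \<gamma>" "e \<notin> \<alpha>" by blast
    then show ?thesis using sub by (auto intro!: prod_zero bexI[of _ e])
  qed
  finally show ?thesis .
qed

lemma expectation_centred_centred:
  assumes M: "\<And>e. e \<in> cells n d \<Longrightarrow> 0 \<le> M e \<and> M e < 1"
    and sub: "\<beta> \<subseteq> cells n d" "\<gamma> \<subseteq> cells n d"
  shows "expect (observation_pmf n d M) (\<lambda>Y. (\<Prod>e\<in>\<beta>. centred M Y e) * (\<Prod>e\<in>\<gamma>. centred M Y e))
      = (if \<beta> = \<gamma> then \<Prod>e\<in>\<gamma>. 1 / (1 - (M e)\<^sup>2) else 0)"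
proof -
  let ?z = "\<lambda>e y. (y - M e) / (1 - (M e)\<^sup>2)"
  let ?f = "\<lambda>e y. (if e \<in> \<beta> then ?z e y else 1) * (if e \<in> \<gamma> then ?z e y else 1)"
  let ?g = "\<lambda>e. if e \<in> \<beta> then (if e \<in> \<gamma> then 1 / (1 - (M e)\<^sup>2) else 0) else of_bool (e \<notin> \<gamma>)"
  have "(\<Prod>e\<in>\<beta>. centred M Y e) * (\<Prod>e\<in>\<gamma>. centred M Y e) = (\<Prod>e\<in>cells n d. ?f e (Y e))" for Y
    using sub by (simp add: prod.distrib prod.If_cases Int_absorb1 centred_def Int_def[symmetric])
  then have "expect (observation_pmf n d M)
        (\<lambda>Y. (\<Prod>e\<in>\<beta>. centred M Y e) * (\<Prod>e\<in>\<gamma>. centred M Y e))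
      = (\<Prod>e\<in>cells n d. ?f e 1 * ((1 + M e) / 2) + ?f e (- 1) * ((1 - M e) / 2))"
    using M by (simp add: expectation_prod_observation[of n d M ?f] less_imp_le)
  also have "\<dots> = (\<Prod>e\<in>cells n d. ?g e)"
  proof (intro prod.cong refl)
    fix e assume "e \<in> cells n d"
    then have "\<bar>M e\<bar> < 1" using M by auto
    note z = centred_noise_moments(1,3)[OF this]
    have "(1 + M e) / 2 + (1 - M e) / 2 = 1" by (simp add: field_simps)
    with z show "?f e 1 * ((1 + M e) / 2) + ?f e (- 1) * ((1 - M e) / 2) = ?g e"
      by (cases "e \<in> \<beta>"; cases "e \<in> \<gamma>") (simp_all)
  qed
  also have "\<dots> = (if \<beta> = \<gamma> then \<Prod>e\<in>\<gamma>. 1 / (1 - (M e)\<^sup>2) else 0)"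
  proof (cases "\<beta> = \<gamma>")
    case True
    have "(\<Prod>e\<in>cells n d. ?g e) = (\<Prod>e\<in>\<gamma>. ?g e)"
      using True sub by (intro prod.mono_neutral_right) auto
    also have "\<dots> = (\<Prod>e\<in>\<gamma>. 1 / (1 - (M e)\<^sup>2))" using True by (intro prod.cong) auto
    finally show ?thesis using True by simp
  next
    case False
    then obtain e where "e \<in> cells n d" "e \<in> \<beta> \<longleftrightarrow> e \<notin> \<gamma>" using sub by blast
    then have "e \<in> cells n d" "?g e = 0" by auto
    then have "(\<Prod>e\<in>cells n d. ?g e) = 0"
      by (intro prod_zero[OF finite_cells] bexI[of _ e])
    then show ?thesis using False by simp
  qed
  finally show ?thesis .
qed

section \<open>Expectations over the random block\<close>

lemma prod_block_matrix:
  assumes "finite \<alpha>"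
  shows "(\<Prod>e\<in>\<alpha>. block_matrix l s t e)
      = l ^ card \<alpha> * of_bool (\<forall>i\<in>fst ` \<alpha>. s i) * of_bool (\<forall>k\<in>col_set \<alpha>. t k)"
  using assms by (induction \<alpha>) (auto simp: block_matrix_def col_set_def)

lemma finite_set_random_subset [simp]: "finite (set_pmf (random_subset m p))"
  unfolding random_subset_def by (intro finite_set_Pi_pmf) (auto intro: finite_subset)

lemma expectation_random_subset_all:
  assumes "A \<subseteq> {1..m}" "0 \<le> p" "p \<le> 1"
  shows "expect (random_subset m p) (\<lambda>s. of_bool (\<forall>i\<in>A. s i)) = p ^ card A"
proof -
  let ?f = "\<lambda>i b. if i \<in> A then of_bool b else (1::real)"
  have fin: "finite A" using assms(1) finite_subset by blast
  have "(of_bool (\<forall>i\<in>A. s i) :: real) = (\<Prod>i\<in>{1..m}. ?f i (s i))" for s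
  proof -
    have "(\<Prod>i\<in>{1..m}. ?f i (s i)) = (\<Prod>i\<in>A. of_bool (s i))"
      using assms(1) by (simp add: prod.If_cases Int_absorb1 Int_def[symmetric])
    also have "\<dots> = of_bool (\<forall>i\<in>A. s i)" using fin by induction auto
    finally show ?thesis by simp
  qed
  then have "expect (random_subset m p) (\<lambda>s. of_bool (\<forall>i\<in>A. s i))
      = (\<Prod>i\<in>{1..m}. expect (bernoulli_pmf p) (?f i))"
    unfolding random_subset_def by (simp only:) (rule expectation_prod_Pi_pmf_finite, auto)
  also have "\<dots> = (\<Prod>i\<in>{1..m}. if i \<in> A then p else 1)"
    using assms by (intro prod.cong) auto
  also have "\<dots> = p ^ card A"
    using assms(1) by (simp add: prod.If_cases Int_absorb1 Int_def[symmetric])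
  finally show ?thesis .
qed

lemma expectation_random_subset_empty:
  assumes "0 \<le> p" "p \<le> 1"
  shows "expect (random_subset m p) (\<lambda>s. of_bool (\<forall>i\<in>{1..m}. \<not> s i)) = (1 - p) ^ m"
proof -
  have "(of_bool (\<forall>i\<in>A. \<not> s i) :: real) = (\<Prod>i\<in>A. of_bool (\<not> s i))" if "finite A" for A :: "nat set" and s
    using that by induction auto
  then have "expect (random_subset m p) (\<lambda>s. of_bool (\<forall>i\<in>{1..m}. \<not> s i))
      = (\<Prod>i\<in>{1..m}. expect (bernoulli_pmf p) (\<lambda>b. of_bool (\<not> b)))"
    unfolding random_subset_def
    by (simp only: finite_atLeastAtMost) (rule expectation_prod_Pi_pmf_finite, auto)
  then show ?thesis using assms by simp
qed

section \<open>The dual certificate\<close>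

text \<open>
  The joint law of \<open>((S, T), Y)\<close>. It keeps \<open>S\<close> and \<open>T\<close>, which \<open>M\<close> does
  not determine: \<open>M = 0\<close> whenever one of the two is empty.
\<close>

definition joint_pmf where
  "joint_pmf n d p q l =
     bind_pmf (pair_pmf (random_subset n p) (random_subset d q))
       (\<lambda>\<omega>. map_pmf (Pair \<omega>) (observation_pmf n d (block_matrix l (fst \<omega>) (snd \<omega>))))"

lemma model_pmf_eq_map_joint_pmf:
  "model_pmf n d Kn Kd l = map_pmf (\<lambda>(\<omega>, Y). (block_matrix l (fst \<omega>) (snd \<omega>), Y))
     (joint_pmf n d (real Kn / real n) (real Kd / real d) l)"
  by (simp add: model_pmf_def signal_pmf_def joint_pmf_def bind_map_pmf map_bind_pmf
      map_pmf_comp case_prod_unfold)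

lemma finite_set_joint_pmf [simp]: "finite (set_pmf (joint_pmf n d p q l))"
  by (auto simp: joint_pmf_def)

lemma integrable_joint_pmf [simp]:
  fixes h :: "_ \<Rightarrow> real"
  shows "integrable (measure_pmf (joint_pmf n d p q l)) h"
  by (intro integrable_measure_pmf_finite) simp

lemma expectation_joint_pmf:
  "expect (joint_pmf n d p q l) h = expect (random_subset n p) (\<lambda>s. expect (random_subset d q)
     (\<lambda>t. expect (observation_pmf n d (block_matrix l s t)) (\<lambda>Y. h ((s, t), Y))))"
  unfolding joint_pmf_def
  by (subst expectation_bind_pmf_finite) (simp_all add: expectation_pair_pmf_finite)

text \<open>
  The free choice of \<open>I\<close> covers both kinds of moment: \<open>fst ` \<alpha>\<close> gives the plain one, and
  \<open>row_set \<alpha>\<close> the one with the indicator of \<open>1 \<in> S\<close>.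
\<close>

lemma expectation_prod_block_matrix:
  assumes "\<alpha> \<subseteq> cells n d" "fst ` \<alpha> \<subseteq> I" "I \<subseteq> {1..n}" "0 \<le> p" "p \<le> 1" "0 \<le> q" "q \<le> 1"
  shows "expect (random_subset n p) (\<lambda>s. expect (random_subset d q)
      (\<lambda>t. of_bool (\<forall>i\<in>I. s i) * (\<Prod>e\<in>\<alpha>. block_matrix l s t e)))
    = l ^ card \<alpha> * p ^ card I * q ^ card (col_set \<alpha>)"
proof -
  have fin: "finite \<alpha>" using finite_subset[OF assms(1)] by simp
  have eq: "of_bool (\<forall>i\<in>I. s i) * (\<Prod>e\<in>\<alpha>. block_matrix l s t e)
      = l ^ card \<alpha> * of_bool (\<forall>i\<in>I. s i) * of_bool (\<forall>k\<in>col_set \<alpha>. t k)" for s t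
    using assms(2) by (auto simp: prod_block_matrix[OF fin])
  have "col_set \<alpha> \<subseteq> {1..d}" using assms(1) by (auto simp: col_set_def cells_def)
  then show ?thesis
    unfolding eq using assms by (simp add: expectation_random_subset_all)
qed

lemma expectation_prod_block_matrix_eq_moment:
  assumes "\<alpha> \<subseteq> cells n d" "0 \<le> p" "p \<le> 1" "0 \<le> q" "q \<le> 1"
  shows "expect (random_subset n p) (\<lambda>s. expect (random_subset d q)
      (\<lambda>t. \<Prod>e\<in>\<alpha>. block_matrix l s t e)) = moment l p q \<alpha>"
proof -
  have fin: "finite \<alpha>" using finite_subset[OF assms(1)] by simp
  have eq: "of_bool (\<forall>i\<in>fst ` \<alpha>. s i) * (\<Prod>e\<in>\<alpha>. block_matrix l s t e)
      = (\<Prod>e\<in>\<alpha>. block_matrix l s t e)" for s t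
    by (auto simp: prod_block_matrix[OF fin])
  have "fst ` \<alpha> \<subseteq> {1..n}" using assms(1) by (auto simp: cells_def)
  then show ?thesis
    using expectation_prod_block_matrix[of \<alpha> n d "fst ` \<alpha>" p q l] assms
    unfolding eq by (simp add: moment_def)
qed

lemma expectation_rooted_prod_block_matrix:
  assumes "n \<ge> 1" "\<alpha> \<subseteq> cells n d" "0 \<le> p" "p \<le> 1" "0 \<le> q" "q \<le> 1"
  shows "expect (random_subset n p) (\<lambda>s. expect (random_subset d q)
      (\<lambda>t. of_bool (s 1) * (\<Prod>e\<in>\<alpha>. block_matrix l s t e))) = rooted_moment l p q \<alpha>"
proof -
  have fin: "finite \<alpha>" using finite_subset[OF assms(2)] by simp
  have eq: "of_bool (\<forall>i\<in>row_set \<alpha>. s i) * (\<Prod>e\<in>\<alpha>. block_matrix l s t e)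
      = of_bool (s 1) * (\<Prod>e\<in>\<alpha>. block_matrix l s t e)" for s t
    by (auto simp: prod_block_matrix[OF fin] row_set_def)
  have "row_set \<alpha> \<subseteq> {1..n}" "fst ` \<alpha> \<subseteq> row_set \<alpha>"
    using assms(1,2) by (auto simp: cells_def row_set_def)
  then show ?thesis
    using expectation_prod_block_matrix[of \<alpha> n d "row_set \<alpha>" p q l] assms
    unfolding eq by (simp add: rooted_moment_def)
qed

text \<open>
  The random variable \<open>\<psi>\<close> of the introduction, which polynomials of degree at most \<open>D\<close> cannot
  tell from the indicator of \<open>1 \<in> S\<close>.
\<close>

definition dual_certificate where
  "dual_certificate n d D p q l = (\<lambda>(\<omega>, Y). \<Sum>\<gamma> | \<gamma> \<subseteq> cells n d \<and> card \<gamma> \<le> D.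
     cumulant l p q \<gamma> * (\<Prod>e\<in>\<gamma>. centred (block_matrix l (fst \<omega>) (snd \<omega>)) Y e))"

lemma finite_subsets_card_le [simp]: "finite {\<gamma>. \<gamma> \<subseteq> cells n d \<and> card \<gamma> \<le> D}"
  by (rule finite_subset[of _ "Pow (cells n d)"]) auto

text \<open>
  Integrating out \<open>Y\<close> leaves only the \<open>\<gamma> \<subseteq> \<alpha>\<close>, each with a moment of
  \<open>\<alpha> - \<gamma>\<close>, so the sum is the one that defines the cumulants. As
  \<open>card \<alpha> \<le> D\<close>, the truncation at \<open>D\<close> removes none of these terms.
\<close>

lemma expectation_dual_certificate_eq:
  assumes "n \<ge> 1" "0 \<le> p" "p \<le> 1" "0 \<le> q" "q \<le> 1" "0 \<le> l" "l < 1"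
    and \<alpha>: "\<alpha> \<subseteq> cells n d" "card \<alpha> \<le> D"
  shows "expect (joint_pmf n d p q l) (\<lambda>x. (\<Prod>e\<in>\<alpha>. snd x e) * dual_certificate n d D p q l x)
      = expect (joint_pmf n d p q l) (\<lambda>x. (\<Prod>e\<in>\<alpha>. snd x e) * of_bool (fst (fst x) 1))"
proof -
  let ?B = "block_matrix l" and ?G = "{\<gamma>. \<gamma> \<subseteq> cells n d \<and> card \<gamma> \<le> D}"
  let ?J = "joint_pmf n d p q l"
  have fin: "finite \<alpha>" using finite_subset[OF \<alpha>(1)] by simp
  have M: "0 \<le> ?B s t e \<and> ?B s t e < 1" for s t e
    using assms by (cases e) (simp add: block_matrix_def)
  have mono: "expect ?J (\<lambda>x. (\<Prod>e\<in>\<alpha>. snd x e) * (\<Prod>e\<in>\<gamma>. centred (?B (fst (fst x)) (snd (fst x))) (snd x) e))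
      = (if \<gamma> \<subseteq> \<alpha> then moment l p q (\<alpha> - \<gamma>) else 0)" if "\<gamma> \<in> ?G" for \<gamma>
  proof -
    have "\<alpha> - \<gamma> \<subseteq> cells n d" using \<alpha> by blast
    then show ?thesis
      using that \<alpha> M assms
      by (simp add: expectation_joint_pmf expectation_monomial_centred
          expectation_prod_block_matrix_eq_moment)
  qed
  have "expect ?J (\<lambda>x. (\<Prod>e\<in>\<alpha>. snd x e) * dual_certificate n d D p q l x)
      = expect ?J (\<lambda>x. \<Sum>\<gamma>\<in>?G. cumulant l p q \<gamma> *
          ((\<Prod>e\<in>\<alpha>. snd x e) * (\<Prod>e\<in>\<gamma>. centred (?B (fst (fst x)) (snd (fst x))) (snd x) e)))"
    by (simp add: dual_certificate_def case_prod_unfold sum_distrib_left mult_ac)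
  also have "\<dots> = (\<Sum>\<gamma>\<in>?G. cumulant l p q \<gamma> * (if \<gamma> \<subseteq> \<alpha> then moment l p q (\<alpha> - \<gamma>) else 0))"
    using mono by (simp add: Bochner_Integration.integral_sum)
  also have "\<dots> = (\<Sum>\<gamma>\<in>Pow \<alpha>. cumulant l p q \<gamma> * (if \<gamma> \<subseteq> \<alpha> then moment l p q (\<alpha> - \<gamma>) else 0))"
  proof (rule sum.mono_neutral_right)
    show "Pow \<alpha> \<subseteq> ?G"
      using \<alpha> fin by (auto dest: card_mono[OF fin])
  qed auto
  also have "\<dots> = rooted_moment l p q \<alpha>"
    by (simp add: rooted_moment_eq_sum_cumulant[OF fin])
  also have "\<dots> = expect ?J (\<lambda>x. (\<Prod>e\<in>\<alpha>. snd x e) * of_bool (fst (fst x) 1))"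
  proof -
    have "expect (observation_pmf n d (?B s t)) (\<lambda>Y. \<Prod>e\<in>\<alpha>. Y e) = (\<Prod>e\<in>\<alpha>. ?B s t e)" for s t
      using expectation_monomial_centred[of n d "?B s t" \<alpha> "{}"] M \<alpha> by simp
    then show ?thesis
      using expectation_rooted_prod_block_matrix[of n \<alpha> d p q l] assms
      by (simp add: expectation_joint_pmf mult.commute)
  qed
  finally show ?thesis .
qed

text \<open>
  Given \<open>M\<close>, products over different edge sets are orthogonal, and every cell contributes a variance
  \<open>1 / (1 - (M e)\<^sup>2) \<le> 2\<close>.
\<close>

lemma expectation_dual_certificate_square_le:
  assumes "0 \<le> p" "p \<le> 1" "0 \<le> q" "q \<le> 1" "0 \<le> l" "l\<^sup>2 \<le> 1 / 2"
  shows "expect (joint_pmf n d p q l) (\<lambda>x. (dual_certificate n d D p q l x)\<^sup>2)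
      \<le> (\<Sum>\<gamma> | \<gamma> \<subseteq> cells n d \<and> card \<gamma> \<le> D. 2 ^ card \<gamma> * (cumulant l p q \<gamma>)\<^sup>2)"
proof -
  let ?G = "{\<gamma>. \<gamma> \<subseteq> cells n d \<and> card \<gamma> \<le> D}" and ?\<kappa> = "cumulant l p q"
  have l1: "l < 1"
  proof (rule ccontr)
    assume "\<not> l < 1"
    then have "1 \<le> l\<^sup>2" by (simp add: one_le_power)
    then show False using assms by simp
  qed
  have inner: "expect (observation_pmf n d M) (\<lambda>Y. (\<Sum>\<gamma>\<in>?G. ?\<kappa> \<gamma> * (\<Prod>e\<in>\<gamma>. centred M Y e))\<^sup>2)
      \<le> (\<Sum>\<gamma>\<in>?G. 2 ^ card \<gamma> * (?\<kappa> \<gamma>)\<^sup>2)" if M': "\<And>e. 0 \<le> M e \<and> M e \<le> l" for M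
  proof -
    let ?O = "observation_pmf n d M" and ?z = "\<lambda>Y \<gamma>. \<Prod>e\<in>\<gamma>. centred M Y e"
    have int: "integrable (measure_pmf ?O) h" for h :: "_ \<Rightarrow> real"
      by (intro integrable_measure_pmf_finite) simp
    have M: "0 \<le> M e \<and> M e < 1" for e using M'[of e] l1 by auto
    have "expect ?O (\<lambda>Y. (\<Sum>\<gamma>\<in>?G. ?\<kappa> \<gamma> * ?z Y \<gamma>)\<^sup>2)
        = expect ?O (\<lambda>Y. \<Sum>\<beta>\<in>?G. \<Sum>\<gamma>\<in>?G. ?\<kappa> \<beta> * ?\<kappa> \<gamma> * (?z Y \<beta> * ?z Y \<gamma>))"
      by (simp add: power2_eq_square sum_product mult_ac)
    also have "\<dots> = (\<Sum>\<beta>\<in>?G. \<Sum>\<gamma>\<in>?G. ?\<kappa> \<beta> * ?\<kappa> \<gamma> * expect ?O (\<lambda>Y. ?z Y \<beta> * ?z Y \<gamma>))"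
      by (simp add: Bochner_Integration.integral_sum int)
    also have "\<dots> = (\<Sum>\<beta>\<in>?G. \<Sum>\<gamma>\<in>?G.
        if \<beta> = \<gamma> then (?\<kappa> \<gamma>)\<^sup>2 * (\<Prod>e\<in>\<gamma>. 1 / (1 - (M e)\<^sup>2)) else 0)"
      using M by (intro sum.cong refl) (auto simp: expectation_centred_centred power2_eq_square)
    also have "\<dots> = (\<Sum>\<gamma>\<in>?G. (?\<kappa> \<gamma>)\<^sup>2 * (\<Prod>e\<in>\<gamma>. 1 / (1 - (M e)\<^sup>2)))"
      by simp
    also have "\<dots> \<le> (\<Sum>\<gamma>\<in>?G. (?\<kappa> \<gamma>)\<^sup>2 * 2 ^ card \<gamma>)"
    proof (intro sum_mono mult_left_mono)
      fix \<gamma>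
      have "(\<Prod>e\<in>\<gamma>. 1 / (1 - (M e)\<^sup>2)) \<le> (\<Prod>e\<in>\<gamma>. 2)"
      proof (rule prod_mono)
        fix e
        have "(M e)\<^sup>2 \<le> l\<^sup>2" using M'[of e] by (intro power_mono) auto
        then have "(M e)\<^sup>2 \<le> 1 / 2" using assms by simp
        then show "0 \<le> 1 / (1 - (M e)\<^sup>2) \<and> 1 / (1 - (M e)\<^sup>2) \<le> 2"
          by (simp add: field_simps)
      qed
      then show "(\<Prod>e\<in>\<gamma>. 1 / (1 - (M e)\<^sup>2)) \<le> 2 ^ card \<gamma>" by simp
    qed simp
    finally show ?thesis by (simp add: mult.commute)
  qed
  have B: "0 \<le> block_matrix l s t e \<and> block_matrix l s t e \<le> l" for s t e
    using assms by (cases e) (simp add: block_matrix_def)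
  have le: "expect r h \<le> c" if "\<And>x. h x \<le> c" "finite (set_pmf r)" for r :: "'z pmf" and h c
    using integral_mono[of "measure_pmf r" h "\<lambda>_. c"] that by (simp add: integrable_measure_pmf_finite)
  show ?thesis
    unfolding expectation_joint_pmf dual_certificate_def
    by (rule le, rule le) (simp_all add: inner B)
qed

text \<open>
  If \<open>T\<close> is empty then \<open>Y\<close> is pure noise, independent of \<open>S\<close>, so the indicator of
  \<open>1 \<in> S\<close> averages to \<open>p\<close> even in the presence of \<open>F Y\<close>.
\<close>

lemma expectation_mult_no_columns:
  fixes F :: "(nat \<times> nat \<Rightarrow> real) \<Rightarrow> real" and n d :: nat
  assumes "n \<ge> 1" "0 \<le> p" "p \<le> 1"
  defines "\<tau> \<equiv> \<lambda>x :: ((nat \<Rightarrow> bool) \<times> (nat \<Rightarrow> bool)) \<times> (nat \<times> nat \<Rightarrow> real).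
      of_bool (\<forall>k\<in>{1..d}. \<not> snd (fst x) k) :: real"
  shows "expect (joint_pmf n d p q l) (\<lambda>x. F (snd x) * (of_bool (fst (fst x) 1) * \<tau> x))
      = expect (joint_pmf n d p q l) (\<lambda>x. F (snd x) * (p * \<tau> x))"
proof -
  define a where "a = expect (observation_pmf n d (\<lambda>_. 0)) F"
  define T where "T = (\<lambda>t. of_bool (\<forall>k\<in>{1..d}. \<not> t k) :: real)"
  have T: "of_bool (\<forall>k\<in>{1..d}. \<not> t k) = T t" for t by (simp add: T_def)
  have obs: "expect (observation_pmf n d (block_matrix l s t)) (\<lambda>Y. F Y * (c * T t)) = a * (c * T t)"
    for s t c
  proof (cases "\<forall>k\<in>{1..d}. \<not> t k")
    case True
    then have "observation_pmf n d (block_matrix l s t) = observation_pmf n d (\<lambda>_. 0)"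
      unfolding observation_pmf_def by (intro Pi_pmf_cong) (auto simp: block_matrix_def cells_def)
    then show ?thesis by (simp add: a_def)
  qed (simp add: T_def)
  have one: "expect (random_subset n p) (\<lambda>s. of_bool (s 1)) = p"
    using expectation_random_subset_all[of "{1}" n p] assms by simp
  show ?thesis
    unfolding expectation_joint_pmf \<tau>_def T fst_conv snd_conv obs
    using one by simp
qed

section \<open>Lower bound on the mean square error\<close>

lemma expectation_no_columns:
  assumes "0 \<le> q" "q \<le> 1"
  shows "expect (joint_pmf n d p q l) (\<lambda>x. of_bool (\<forall>k\<in>{1..d}. \<not> snd (fst x) k)) = (1 - q) ^ d"
  using expectation_random_subset_empty[OF assms, of d] by (simp add: expectation_joint_pmf)

lemma joint_pmf_support:
  assumes "x \<in> set_pmf (joint_pmf n d p q l)" "e \<in> cells n d"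
  shows "snd x e = 1 \<or> snd x e = - 1"
proof -
  obtain M where "snd x \<in> set_pmf (observation_pmf n d M)"
    using assms(1) by (auto simp: joint_pmf_def)
  then show ?thesis using assms(2) by (rule observation_pmf_support)
qed

text \<open>
  Signs square to 1, so on the support of \<open>Y\<close> only the parity of an exponent matters and every polynomial is
  multilinear.
\<close>

lemma sign_monomial_eq_prod_odd:
  fixes y :: "'a \<Rightarrow> real"
  assumes "finite A" "\<And>e. e \<in> A \<Longrightarrow> y e = 1 \<or> y e = - 1"
  shows "(\<Prod>e\<in>A. y e ^ a e) = (\<Prod>e | e \<in> A \<and> odd (a e). y e)"
proof -
  have "(\<Prod>e\<in>A. y e ^ a e) = (\<Prod>e\<in>A. if odd (a e) then y e else 1)"
    using assms(2) by (intro prod.cong) fastforce+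
  then show ?thesis using assms(1) by (simp add: prod.If_cases Int_def)
qed

lemma card_odd_exponents_le:
  fixes a :: "'a \<Rightarrow> nat"
  assumes "finite A"
  shows "card {e \<in> A. odd (a e)} \<le> (\<Sum>e\<in>A. a e)"
proof -
  have "card {e \<in> A. odd (a e)} = (\<Sum>e\<in>A. of_bool (odd (a e)))"
    using assms by (simp add: of_bool_def sum.If_cases Int_def)
  also have "\<dots> \<le> (\<Sum>e\<in>A. a e)"
    by (intro sum_mono) (auto elim: oddE)
  finally show ?thesis .
qed

lemma target_block_matrix:
  assumes "0 < l"
  shows "target d (block_matrix l s t) = of_bool (s 1) * (1 - of_bool (\<forall>k\<in>{1..d}. \<not> t k))"
  using assms by (auto simp: target_def block_matrix_def)

definition no_columns ::
    "nat \<Rightarrow> ((nat \<Rightarrow> bool) \<times> (nat \<Rightarrow> bool)) \<times> (nat \<times> nat \<Rightarrow> real) \<Rightarrow> real" where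
  "no_columns d x = of_bool (\<forall>k\<in>{1..d}. \<not> snd (fst x) k)"

lemma expectation_polynomial_target:
  assumes f: "f \<in> polys_le n d D"
    and par: "n \<ge> 1" "0 \<le> p" "p \<le> 1" "0 \<le> q" "q \<le> 1" "0 < l" "l < 1"
  shows "expect (joint_pmf n d p q l) (\<lambda>x. f (snd x) * target d (block_matrix l (fst (fst x)) (snd (fst x))))
      = expect (joint_pmf n d p q l) (\<lambda>x. f (snd x) * (dual_certificate n d D p q l x - p * no_columns d x))"
proof -
  let ?J = "joint_pmf n d p q l"
  let ?\<psi> = "dual_certificate n d D p q l" and ?s = "\<lambda>x. of_bool (fst (fst x) 1) :: real"
  obtain A c where A: "finite A" "\<And>a. a \<in> A \<Longrightarrow> (\<Sum>e\<in>cells n d. a e) \<le> D"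
    and f_eq: "f = (\<lambda>Y. \<Sum>a\<in>A. c a * (\<Prod>e\<in>cells n d. Y e ^ a e))"
    using f by (auto simp: polys_le_def)
  have mono: "expect ?J (\<lambda>x. (\<Prod>e\<in>cells n d. snd x e ^ a e) * ?\<psi> x)
      = expect ?J (\<lambda>x. (\<Prod>e\<in>cells n d. snd x e ^ a e) * ?s x)" if "a \<in> A" for a
  proof -
    let ?\<alpha> = "{e \<in> cells n d. odd (a e)}"
    have "expect ?J (\<lambda>x. (\<Prod>e\<in>cells n d. snd x e ^ a e) * h x) = expect ?J (\<lambda>x. (\<Prod>e\<in>?\<alpha>. snd x e) * h x)"
      for h
      by (rule integral_cong_AE)
        (auto simp: AE_measure_pmf_iff sign_monomial_eq_prod_odd joint_pmf_support)
    moreover have "card ?\<alpha> \<le> D"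
      using card_odd_exponents_le[of "cells n d" a] A(2)[OF that] by simp
    ultimately show ?thesis
      using expectation_dual_certificate_eq[of n p q l ?\<alpha> d D] par by simp
  qed
  have lin: "expect ?J (\<lambda>x. f (snd x) * h x)
      = (\<Sum>a\<in>A. c a * expect ?J (\<lambda>x. (\<Prod>e\<in>cells n d. snd x e ^ a e) * h x))" for h
    unfolding f_eq by (simp add: sum_distrib_right mult.assoc Bochner_Integration.integral_sum)
  have 1: "expect ?J (\<lambda>x. f (snd x) * ?s x) = expect ?J (\<lambda>x. f (snd x) * ?\<psi> x)"
    unfolding lin using mono by simp
  have 2: "expect ?J (\<lambda>x. f (snd x) * (?s x * no_columns d x)) = expect ?J (\<lambda>x. f (snd x) * (p * no_columns d x))"
    unfolding no_columns_def by (rule expectation_mult_no_columns) (use par in auto)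
  have "expect ?J (\<lambda>x. f (snd x) * target d (block_matrix l (fst (fst x)) (snd (fst x))))
      = expect ?J (\<lambda>x. f (snd x) * ?s x - f (snd x) * (?s x * no_columns d x))"
    using par by (simp add: target_block_matrix no_columns_def algebra_simps)
  also have "\<dots> = expect ?J (\<lambda>x. f (snd x) * ?\<psi> x - f (snd x) * (p * no_columns d x))"
    using 1 2 by simp
  finally show ?thesis by (simp add: algebra_simps)
qed

lemma expectation_target:
  assumes "n \<ge> 1" "0 \<le> p" "p \<le> 1" "0 \<le> q" "q \<le> 1" "0 < l"
  shows "expect (joint_pmf n d p q l) (\<lambda>x. (target d (block_matrix l (fst (fst x)) (snd (fst x))))\<^sup>2)
      = p * (1 - (1 - q) ^ d)"
proof -
  let ?J = "joint_pmf n d p q l" and ?s = "\<lambda>x. of_bool (fst (fst x) 1) :: real"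
  have "expect ?J (\<lambda>x. (target d (block_matrix l (fst (fst x)) (snd (fst x))))\<^sup>2)
      = expect ?J (\<lambda>x. ?s x - 1 * (?s x * no_columns d x))"
    using assms(6) by (intro Bochner_Integration.integral_cong refl) (auto simp: target_block_matrix no_columns_def)
  also have "\<dots> = expect ?J ?s - expect ?J (\<lambda>x. 1 * (?s x * no_columns d x))"
    by (rule Bochner_Integration.integral_diff) simp_all
  also have "expect ?J (\<lambda>x. 1 * (?s x * no_columns d x)) = expect ?J (\<lambda>x. 1 * (p * no_columns d x))"
    unfolding no_columns_def using assms by (intro expectation_mult_no_columns[where F = "\<lambda>_. 1"]) auto
  also have "\<dots> = p * (1 - q) ^ d"
    using expectation_no_columns[of q n d p l] assms by (simp add: no_columns_def)
  also have "expect ?J ?s = p"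
    using expectation_random_subset_all[of "{1}" n p] assms by (simp add: expectation_joint_pmf)
  finally show ?thesis by (simp add: algebra_simps)
qed

text \<open>
  The duality argument, with \<open>\<phi> = \<psi> - p * no_columns\<close>. Here \<open>6 * p\<^sup>2\<close> is twice the
  bound \<open>2 * p\<^sup>2\<close> for \<open>E[\<psi>\<^sup>2]\<close> plus twice the bound \<open>p\<^sup>2\<close> for
  the other summand.
\<close>

lemma mean_square_error_ge:
  assumes f: "f \<in> polys_le n d D"
    and par: "n \<ge> 1" "0 \<le> p" "p \<le> 1" "0 \<le> q" "q \<le> 1" "0 < l" "l\<^sup>2 \<le> 1 / 2"
    and small: "32 * real D ^ 3 * l\<^sup>2 * (real d * q\<^sup>2 + real n * p\<^sup>2 + real D) \<le> 1 / 2"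
  shows "expect (joint_pmf n d p q l) (\<lambda>x. (f (snd x) - target d (block_matrix l (fst (fst x)) (snd (fst x))))\<^sup>2)
      \<ge> p * (1 - (1 - q) ^ d) - 6 * p\<^sup>2"
proof -
  let ?J = "joint_pmf n d p q l" and ?\<psi> = "dual_certificate n d D p q l"
  let ?x = "\<lambda>x. target d (block_matrix l (fst (fst x)) (snd (fst x)))"
  let ?\<phi> = "\<lambda>x. ?\<psi> x - p * no_columns d x"
  have "l < 1"
  proof (rule ccontr)
    assume "\<not> l < 1"
    then have "1 \<le> l\<^sup>2" by (simp add: one_le_power)
    then show False using par by simp
  qed
  then have corr: "expect ?J (\<lambda>x. f (snd x) * ?x x) = expect ?J (\<lambda>x. f (snd x) * ?\<phi> x)"
    using expectation_polynomial_target[OF f] par by simp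
  have "expect ?J (\<lambda>x. (?\<phi> x)\<^sup>2) \<le> expect ?J (\<lambda>x. 2 * (?\<psi> x)\<^sup>2 + 2 * p\<^sup>2)"
  proof (rule integral_mono)
    fix x
    have "(?\<phi> x)\<^sup>2 + (?\<psi> x + p * no_columns d x)\<^sup>2 = 2 * (?\<psi> x)\<^sup>2 + 2 * p\<^sup>2 * (no_columns d x)\<^sup>2"
      by (simp add: power2_eq_square algebra_simps)
    moreover have "2 * p\<^sup>2 * (no_columns d x)\<^sup>2 \<le> 2 * p\<^sup>2" by (simp add: no_columns_def)
    ultimately show "(?\<phi> x)\<^sup>2 \<le> 2 * (?\<psi> x)\<^sup>2 + 2 * p\<^sup>2"
      using zero_le_power2[of "?\<psi> x + p * no_columns d x"] by linarith
  qed simp_all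
  also have "\<dots> = 2 * expect ?J (\<lambda>x. (?\<psi> x)\<^sup>2) + 2 * p\<^sup>2" by simp
  also have "expect ?J (\<lambda>x. (?\<psi> x)\<^sup>2)
      \<le> (\<Sum>\<gamma> | \<gamma> \<subseteq> cells n d \<and> card \<gamma> \<le> D. 2 ^ card \<gamma> * (cumulant l p q \<gamma>)\<^sup>2)"
    using par by (intro expectation_dual_certificate_square_le) auto
  also have "\<dots> \<le> 2 * p\<^sup>2"
    using par small by (intro sum_cumulant_squares_le) auto
  finally have norm: "expect ?J (\<lambda>x. (?\<phi> x)\<^sup>2) \<le> 6 * p\<^sup>2" by simp
  have square_diff: "(a - b)\<^sup>2 = a\<^sup>2 - 2 * (a * b) + b\<^sup>2" for a b :: real
    by (simp add: power2_diff)
  have "0 \<le> expect ?J (\<lambda>x. (f (snd x) - ?\<phi> x)\<^sup>2)" by simp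
  also have "\<dots> = expect ?J (\<lambda>x. (f (snd x))\<^sup>2 - 2 * (f (snd x) * ?\<phi> x) + (?\<phi> x)\<^sup>2)"
    by (simp only: square_diff)
  also have "\<dots> = expect ?J (\<lambda>x. (f (snd x))\<^sup>2) - 2 * expect ?J (\<lambda>x. f (snd x) * ?x x) + expect ?J (\<lambda>x. (?\<phi> x)\<^sup>2)"
    unfolding corr
    by (simp only: Bochner_Integration.integral_add Bochner_Integration.integral_diff
        integral_mult_right_zero integrable_joint_pmf)
  finally have a: "0 \<le> expect ?J (\<lambda>x. (f (snd x))\<^sup>2) - 2 * expect ?J (\<lambda>x. f (snd x) * ?x x) + expect ?J (\<lambda>x. (?\<phi> x)\<^sup>2)" .
  have "expect ?J (\<lambda>x. (f (snd x) - ?x x)\<^sup>2)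
      = expect ?J (\<lambda>x. (f (snd x))\<^sup>2 - 2 * (f (snd x) * ?x x) + (?x x)\<^sup>2)"
    by (simp only: square_diff)
  also have "\<dots> = expect ?J (\<lambda>x. (f (snd x))\<^sup>2) - 2 * expect ?J (\<lambda>x. f (snd x) * ?x x) + expect ?J (\<lambda>x. (?x x)\<^sup>2)"
    by simp
  also have "expect ?J (\<lambda>x. (?x x)\<^sup>2) = p * (1 - (1 - q) ^ d)"
    using par by (intro expectation_target) auto
  finally show ?thesis using a norm by linarith
qed

section \<open>The regime of the parameters\<close>

text \<open>
  The left hand side is at most \<open>96 * D ^ 4 * \<delta>\<^sup>2\<close>, and
  \<open>\<delta> \<le> D powr -8 \<le> 2 powr -8\<close>. This is where the exponent 8 enters, and why \<open>c0 = 1\<close>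
  is large enough.
\<close>

lemma smallness_condition:
  fixes \<delta> l p q :: real
  assumes D: "D \<ge> 2" and \<delta>: "0 \<le> \<delta>" "\<delta> \<le> real D powr - 8"
    and "0 \<le> l" "l \<le> \<delta>" "l\<^sup>2 * (real d * q\<^sup>2) \<le> \<delta>\<^sup>2" "l\<^sup>2 * (real n * p\<^sup>2) \<le> \<delta>\<^sup>2"
  shows "32 * real D ^ 3 * l\<^sup>2 * (real d * q\<^sup>2 + real n * p\<^sup>2 + real D) \<le> 1 / 2"
    and "\<delta> \<le> 1 / 256"
proof -
  have pos: "0 < real D" and D2: "2 \<le> real D" using D by auto
  have "real D powr - 8 = 1 / real D ^ 8"
    using pos by (simp add: powr_minus powr_numeral divide_inverse)
  then have "\<delta> \<le> 1 / real D ^ 8" using \<delta>(2) by simp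
  then have le: "\<delta> * real D ^ 8 \<le> 1" using pos by (simp add: pos_le_divide_eq)
  have D4: "16 \<le> real D ^ 4" using power_mono[OF D2, of 4] by simp
  have D8: "256 \<le> real D ^ 8" using power_mono[OF D2, of 8] by simp
  then have "\<delta> * 256 \<le> \<delta> * real D ^ 8" using \<delta> by (intro mult_left_mono)
  then show d256: "\<delta> \<le> 1 / 256" using le by linarith
  have "l\<^sup>2 \<le> \<delta>\<^sup>2" using assms by (intro power_mono) auto
  then have "l\<^sup>2 * real D \<le> \<delta>\<^sup>2 * real D" using pos by simp
  moreover have "\<delta>\<^sup>2 \<le> \<delta>\<^sup>2 * real D" using D2 by (simp add: mult_le_cancel_left1)
  ultimately have "l\<^sup>2 * (real d * q\<^sup>2 + real n * p\<^sup>2 + real D) \<le> 3 * (\<delta>\<^sup>2 * real D)"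
    using assms(6,7) unfolding distrib_left by linarith
  then have "32 * real D ^ 3 * (l\<^sup>2 * (real d * q\<^sup>2 + real n * p\<^sup>2 + real D))
      \<le> 32 * real D ^ 3 * (3 * (\<delta>\<^sup>2 * real D))"
    using pos by (intro mult_left_mono) auto
  also have "\<dots> = 96 * \<delta> * (\<delta> * real D ^ 4)"
    by (simp add: power2_eq_square power4_eq_xxxx power3_eq_cube)
  also have "\<dots> \<le> 96 * \<delta> * 1"
  proof (rule mult_left_mono)
    have "\<delta> * real D ^ 4 \<le> \<delta> * real D ^ 8"
      using \<delta> D2 by (intro mult_left_mono power_increasing) auto
    then show "\<delta> * real D ^ 4 \<le> 1" using le by linarith
  qed (use \<delta> in auto)
  also have "\<dots> \<le> 1 / 2" using d256 by simp
  finally show "32 * real D ^ 3 * l\<^sup>2 * (real d * q\<^sup>2 + real n * p\<^sup>2 + real D) \<le> 1 / 2"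
    by (simp add: mult.assoc)
qed

lemma prob_no_columns_le:
  assumes "d \<ge> 1" "K \<in> {1..d}"
  shows "(1 - real K / real d) ^ d \<le> 1 / 2"
proof -
  have "(1 - real K / real d) ^ d \<le> (1 - 1 / real d) ^ d"
    using assms by (intro power_mono) (auto simp: field_simps)
  also have "\<dots> \<le> exp (- 1)"
    using exp_ge_one_minus_x_over_n_power_n[of 1 d] assms by simp
  also have "\<dots> \<le> 1 / 2"
  proof -
    have "(2::real) \<le> exp 1" using exp_ge_add_one_self[of 1] by simp
    then show ?thesis by (simp add: exp_minus field_simps)
  qed
  finally show ?thesis .
qed

theorem theorem4p2:
  "\<exists>c0::real. c0 > 0 \<and>
     (\<forall>cs\<ge>c0. \<forall>(D::nat) (n::nat) (d::nat) (Kn::nat) (Kd::nat) (l::real).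
        D \<ge> 2 \<longrightarrow> n \<ge> 1 \<longrightarrow> d \<ge> 1 \<longrightarrow> Kn \<in> {1..n} \<longrightarrow> Kd \<in> {1..d} \<longrightarrow> l \<in> {0<..<1} \<longrightarrow>
        Max {real Kn / real n, real Kd / real d, l * real Kn / sqrt (real n),
             l * real Kd / sqrt (real d), l} \<le> real D powr (- 8 * cs) \<longrightarrow>
        (INF f\<in>polys_le n d D.
           measure_pmf.expectation (model_pmf n d Kn Kd l) (\<lambda>(M, Y). (f Y - target d M)\<^sup>2))
        \<ge> measure_pmf.expectation (model_pmf n d Kn Kd l) (\<lambda>(M, Y). (target d M)\<^sup>2) / 2)"
proof (intro exI[of _ 1] conjI allI impI)
  fix cs l :: real and D n d Kn Kd :: nat
  assume cs: "1 \<le> cs" and D: "D \<ge> 2" and n: "n \<ge> 1" and d: "d \<ge> 1"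
    and Kn: "Kn \<in> {1..n}" and Kd: "Kd \<in> {1..d}" and l: "l \<in> {0<..<1}"
    and Max: "Max {real Kn / real n, real Kd / real d, l * real Kn / sqrt (real n),
             l * real Kd / sqrt (real d), l} \<le> real D powr (- 8 * cs)"
  let ?p = "real Kn / real n" and ?q = "real Kd / real d"
  define \<delta> where "\<delta> = real D powr (- 8 * cs)"
  have p: "0 \<le> ?p" "?p \<le> 1" and q: "0 \<le> ?q" "?q \<le> 1" using Kn Kd by auto
  have \<delta>: "?p \<le> \<delta>" "l * real Kn / sqrt (real n) \<le> \<delta>" "l * real Kd / sqrt (real d) \<le> \<delta>" "l \<le> \<delta>"
    using Max by (simp_all add: \<delta>_def)
  have \<delta>8: "0 \<le> \<delta>" "\<delta> \<le> real D powr - 8"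
    using cs D by (auto simp: \<delta>_def intro: powr_mono)
  have sq: "l\<^sup>2 * (real m * (real K / real m)\<^sup>2) \<le> \<delta>\<^sup>2"
    if "l * real K / sqrt (real m) \<le> \<delta>" "m \<ge> 1" for K m
  proof -
    have "l\<^sup>2 * (real m * (real K / real m)\<^sup>2) = (l * real K / sqrt (real m))\<^sup>2"
      using that(2) by (simp add: power_divide power_mult_distrib power2_eq_square)
    also have "\<dots> \<le> \<delta>\<^sup>2" using that l by (intro power_mono) auto
    finally show ?thesis .
  qed
  have small: "32 * real D ^ 3 * l\<^sup>2 * (real d * ?q\<^sup>2 + real n * ?p\<^sup>2 + real D) \<le> 1 / 2"
    and \<delta>256: "\<delta> \<le> 1 / 256"
    using smallness_condition[OF D \<delta>8, of l d ?q n ?p] sq \<delta> l n d by auto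
  have "l\<^sup>2 \<le> 1 / 2"
  proof -
    have "l\<^sup>2 \<le> l" using l by (simp add: power2_eq_square mult_left_le)
    then show ?thesis using \<delta> \<delta>256 by linarith
  qed
  note mse = mean_square_error_ge[OF _ n p q _ this small]
  have target: "expect (model_pmf n d Kn Kd l) (\<lambda>(M, Y). (target d M)\<^sup>2) = ?p * (1 - (1 - ?q) ^ d)"
    using expectation_target[OF n p q, of l d] l
    by (simp add: model_pmf_eq_map_joint_pmf case_prod_unfold)
  \<comment> \<open>Since \<open>p \<le> 1 / 256\<close>, the error \<open>6 * p\<^sup>2\<close> is less than half of the second moment of the target.\<close>
  have gap: "?p * (1 - (1 - ?q) ^ d) / 2 \<le> ?p * (1 - (1 - ?q) ^ d) - 6 * ?p\<^sup>2"
  proof -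
    have "12 * ?p \<le> 1 / 2" using \<delta> \<delta>256 by linarith
    also have "1 / 2 \<le> 1 - (1 - ?q) ^ d" using prob_no_columns_le[OF d Kd] by linarith
    finally have "?p * (12 * ?p) \<le> ?p * (1 - (1 - ?q) ^ d)" using p by (intro mult_left_mono)
    moreover have "x / 2 \<le> x - 6 * y\<^sup>2" if "y * (12 * y) \<le> x" for x y :: real
      using that by (simp add: power2_eq_square)
    ultimately show ?thesis by blast
  qed
  show "(INF f\<in>polys_le n d D. expect (model_pmf n d Kn Kd l) (\<lambda>(M, Y). (f Y - target d M)\<^sup>2))
      \<ge> expect (model_pmf n d Kn Kd l) (\<lambda>(M, Y). (target d M)\<^sup>2) / 2"
  proof (rule cINF_greatest)
    have "(\<lambda>Y. 0) \<in> polys_le n d D"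
      unfolding polys_le_def by (auto intro!: exI[of _ "{}"])
    then show "polys_le n d D \<noteq> {}" by blast
    fix f assume "f \<in> polys_le n d D"
    then have "?p * (1 - (1 - ?q) ^ d) - 6 * ?p\<^sup>2
        \<le> expect (model_pmf n d Kn Kd l) (\<lambda>(M, Y). (f Y - target d M)\<^sup>2)"
      using mse[of f] l by (simp add: model_pmf_eq_map_joint_pmf case_prod_unfold)
    then show "expect (model_pmf n d Kn Kd l) (\<lambda>(M, Y). (target d M)\<^sup>2) / 2
        \<le> expect (model_pmf n d Kn Kd l) (\<lambda>(M, Y). (f Y - target d M)\<^sup>2)"
      unfolding target by (rule order.trans[OF gap])
  qed
qed simp

end
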